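(* The map $q_{3,2}\circ\beta_{3,2}:B_3\to\overline{\Gamma_{3,2}}$ is surjective. However, for every prime $p>2$, the map $q_{3,p}\circ\beta_{3,p}:B_3\to\overline{\Gamma_{3,p}}$ is not surjective; moreover, the index $[\overline{\Gamma_{3,p}}: q_{3,p}\circ\beta_{3,p}(B_3)]$ is infinite.
   Context: $B_3=\langle \sigma_1,\sigma_2\mid \sigma_1\sigma_2\sigma_1=\sigma_2\sigma_1\sigma_2\rangle$ is the 3-strand braid group. For a prime $p$, the Burau representation modulo $p$ is $\beta_{3,p}:B_3\to \mathrm{GL}(3,\mathbb{F}_p[t,t^{-1}])$, $$\sigma_1\mapsto\begin{pmatrix}1-t&t&0\\1&0&0\\0&0&1\end{pmatrix},\qquad \sigma_2\mapsto\begin{pmatrix}1&0&0\\0&1-t&t\\0&1&0\end{pmatrix}.$$ For a matrix $A$ with Laurent polynomial entries, $\overline{A}$ is obtained by substituting $t\mapsto t^{-1}$ in every entry. Let $v=(t,t^2,t^3)$ (row vector), $\overrightarrow{1}=(1,1,1)^T$, and $$J_3=\begin{pmatrix}1&-t^{-1}&-t^{-1}\\-t&1&-t^{-1}\\-t&-t&1\end{pmatrix}.$$ The target group is $$\Gamma_{3,p}=\{A\in\mathrm{GL}(3,\mathbb{F}_p[t,t^{-1}]) : vA=v,\ A\overrightarrow{1}=\overrightarrow{1},\ \overline{A}J_3A^T=J_3,\ A|_{t=1}\in S_3\},$$ where $S_3\subset\mathrm{GL}(3,\mathbb{F}_p)$ denotes the group of $3\times 3$ permutation matrices. The image of $\beta_{3,p}$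 lies in $\Gamma_{3,p}$. $\overline{\Gamma_{3,p}}$ is the quotient of $\Gamma_{3,p}$ by its center and $q_{3,p}:\Gamma_{3,p}\to\overline{\Gamma_{3,p}}$ is the quotient map. *)

theory Defs
  imports
    "HOL-Analysis.Analysis"
    "HOL-Algebra.Algebra"
    "HOL-Library.Poly_Mapping"
    "Berlekamp_Zassenhaus.Finite_Field"
begin

section \<open>The braid group on three strands\<close>

datatype braid_gen = Sigma1 | Sigma2

text \<open>A letter \<open>(s, True)\<close> stands for the generator \<open>s\<close>, and \<open>(s, False)\<close> for its formal inverse.\<close>

type_synonym braid_word = "(braid_gen \<times> bool) list"

inductive braid_eq :: "braid_word \<Rightarrow> braid_word \<Rightarrow> bool" where
  braid_refl: "braid_eq w w"
| braid_sym: "braid_eq u w \<Longrightarrow> braid_eq w u"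
| braid_trans: "braid_eq u v \<Longrightarrow> braid_eq v w \<Longrightarrow> braid_eq u w"
| braid_cancel: "braid_eq (u @ [(s, e), (s, \<not> e)] @ w) (u @ w)"
| braid_rel: "braid_eq (u @ [(Sigma1, True), (Sigma2, True), (Sigma1, True)] @ w)
                       (u @ [(Sigma2, True), (Sigma1, True), (Sigma2, True)] @ w)"

quotient_type braid3 = braid_word / braid_eq
  by (intro equivpI reflpI sympI transpI) (fact braid_refl, erule braid_sym, erule (1) braid_trans)

lemma braid_eq_prepend: "braid_eq u w \<Longrightarrow> braid_eq (x @ u) (x @ w)"
proof (induction rule: braid_eq.induct)
  case (braid_cancel u s e w)
  then show ?case using braid_eq.braid_cancel[of "x @ u" s e w] by simp
next
  case (braid_rel u w)
  then show ?case using braid_eq.braid_rel[of "x @ u" w] by simp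
qed (fact braid_refl, erule braid_sym, erule (1) braid_trans)

lemma braid_eq_append: "braid_eq u w \<Longrightarrow> braid_eq (u @ x) (w @ x)"
proof (induction rule: braid_eq.induct)
  case (braid_cancel u s e w)
  then show ?case using braid_eq.braid_cancel[of u s e "w @ x"] by simp
next
  case (braid_rel u w)
  then show ?case using braid_eq.braid_rel[of u "w @ x"] by simp
qed (fact braid_refl, erule braid_sym, erule (1) braid_trans)

lift_definition braid_mult :: "braid3 \<Rightarrow> braid3 \<Rightarrow> braid3" is "(@)"
  by (rule braid_trans[OF braid_eq_append braid_eq_prepend])

lift_definition braid_one :: braid3 is "[]" .

definition B3 :: "braid3 monoid" where
  "B3 = \<lparr>carrier = UNIV, monoid.mult = braid_mult, one = braid_one\<rparr>"

lemma braid_eq_inverse: "braid_eq (rev (map (\<lambda>(s, e). (s, \<not> e)) w) @ w) []"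
proof (induction w)
  case (Cons a w)
  obtain s e where a: "a = (s, e)" by force
  have "braid_eq (rev (map (\<lambda>(s, e). (s, \<not> e)) w) @ [(s, \<not> e), (s, \<not> \<not> e)] @ w)
                 (rev (map (\<lambda>(s, e). (s, \<not> e)) w) @ w)"
    by (rule braid_cancel)
  from braid_trans[OF this Cons.IH] show ?case unfolding a by simp
qed (simp add: braid_refl)

lemma group_B3: "group B3"
proof (rule groupI)
  fix x assume "x \<in> carrier B3"
  have "\<exists>y. braid_mult y x = braid_one"
    by transfer (blast intro: braid_eq_inverse)
  then show "\<exists>y\<in>carrier B3. y \<otimes>\<^bsub>B3\<^esub> x = \<one>\<^bsub>B3\<^esub>"
    by (simp add: B3_def)
qed (simp_all add: B3_def, (transfer, simp add: braid_refl)+)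


section \<open>Laurent polynomials\<close>

text \<open>The Laurent polynomial ring \<open>R[t, t\<^sup>-\<^sup>1]\<close> is the group ring of the integers: a finitely
  supported map sends an exponent to its coefficient, and the product is convolution.\<close>

type_synonym 'a laurent = "int \<Rightarrow>\<^sub>0 'a"

definition lt :: "'a::comm_ring_1 laurent" where
  "lt = Poly_Mapping.single 1 1"

definition lt_inv :: "'a::comm_ring_1 laurent" where
  "lt_inv = Poly_Mapping.single (-1) 1"

text \<open>The substitution of \<open>t\<^sup>-\<^sup>1\<close> for \<open>t\<close>: the coefficient of the result at \<open>k\<close> is the original
  coefficient at \<open>- k\<close>.\<close>

definition laurent_bar :: "'a::comm_ring_1 laurent \<Rightarrow> 'a laurent" where
  "laurent_bar f = Poly_Mapping.map_key uminus f"

definition laurent_at_1 :: "'a::comm_ring_1 laurent \<Rightarrow> 'a" where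
  "laurent_at_1 f = (\<Sum>k\<in>Poly_Mapping.keys f. Poly_Mapping.lookup f k)"

lemma lt_lt_inv [simp]: "lt * lt_inv = 1" "lt_inv * lt = 1"
  by (simp_all add: lt_def lt_inv_def mult_single flip: single_one)

lemma lookup_laurent_bar: "Poly_Mapping.lookup (laurent_bar f) k = Poly_Mapping.lookup f (- k)"
  by (simp add: laurent_bar_def map_key.rep_eq)

lemma laurent_bar_single: "laurent_bar (Poly_Mapping.single k c) = Poly_Mapping.single (- k) c"
  by (rule poly_mapping_eqI) (auto simp: lookup_laurent_bar lookup_single when_def)

lemma laurent_bar_add: "laurent_bar (f + g) = laurent_bar f + laurent_bar g"
  by (rule poly_mapping_eqI) (simp add: lookup_laurent_bar lookup_add)

lemma laurent_bar_uminus: "laurent_bar (- f) = - laurent_bar f"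
  by (rule poly_mapping_eqI) (simp add: lookup_laurent_bar)

lemma laurent_bar_0 [simp]: "laurent_bar 0 = 0"
  by (rule poly_mapping_eqI) (simp add: lookup_laurent_bar)

lemma laurent_bar_1 [simp]: "laurent_bar 1 = 1"
  using laurent_bar_single[of 0 1] by simp

lemma laurent_induct [case_names single add]:
  fixes f :: "'a::comm_ring_1 laurent"
  assumes "\<And>k c. P (Poly_Mapping.single k c)" "\<And>f g. P f \<Longrightarrow> P g \<Longrightarrow> P (f + g)"
  shows "P f"
proof (induction f rule: Poly_Mapping.update_induct)
  case const
  then show ?case using assms(1)[of 0 0] by simp
next
  case (update f a b)
  have "Poly_Mapping.update a b f = Poly_Mapping.single a b + f"
    using update(1)
    by (intro poly_mapping_eqI)
      (auto simp: lookup_update lookup_add lookup_single when_def in_keys_iff)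
  with update assms show ?case by simp
qed

lemma laurent_bar_mult: "laurent_bar (f * g) = laurent_bar f * laurent_bar g"
proof (induction f rule: laurent_induct)
  case (single k c)
  show ?case
    by (induction g rule: laurent_induct)
      (simp_all add: laurent_bar_single laurent_bar_add mult_single distrib_left)
qed (simp add: distrib_right laurent_bar_add)

lemma laurent_bar_sum: "laurent_bar (sum f S) = (\<Sum>i\<in>S. laurent_bar (f i))"
  by (induction S rule: infinite_finite_induct) (simp_all add: laurent_bar_add)

lemma laurent_at_1_superset:
  assumes "finite S" "Poly_Mapping.keys f \<subseteq> S"
  shows "laurent_at_1 f = (\<Sum>k\<in>S. Poly_Mapping.lookup f k)"
  unfolding laurent_at_1_def using assms
  by (intro sum.mono_neutral_left) (auto simp: in_keys_iff)

lemma laurent_at_1_single: "laurent_at_1 (Poly_Mapping.single k c) = c"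
  by (subst laurent_at_1_superset[of "{k}"]) auto

lemma laurent_at_1_add: "laurent_at_1 (f + g) = laurent_at_1 f + laurent_at_1 g"
proof -
  let ?S = "Poly_Mapping.keys f \<union> Poly_Mapping.keys g"
  have "Poly_Mapping.keys (f + g) \<subseteq> ?S" by (rule Poly_Mapping.keys_add)
  then show ?thesis
    by (simp add: laurent_at_1_superset[of ?S] lookup_add sum.distrib)
qed

lemma laurent_at_1_mult: "laurent_at_1 (f * g) = laurent_at_1 f * laurent_at_1 g"
proof (induction f rule: laurent_induct)
  case (single k c)
  show ?case
    by (induction g rule: laurent_induct)
      (simp_all add: laurent_at_1_single laurent_at_1_add mult_single distrib_left)
qed (simp add: distrib_right laurent_at_1_add)

lemma laurent_at_1_0 [simp]: "laurent_at_1 0 = 0"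
  by (simp add: laurent_at_1_def)

lemma laurent_at_1_1 [simp]: "laurent_at_1 1 = 1"
  using laurent_at_1_single[of 0 1] by simp

lemma laurent_at_1_sum: "laurent_at_1 (sum f S) = (\<Sum>i\<in>S. laurent_at_1 (f i))"
  by (induction S rule: infinite_finite_induct) (simp_all add: laurent_at_1_add)

lemma laurent_at_1_uminus: "laurent_at_1 (- f) = - laurent_at_1 f"
  using laurent_at_1_add[of f "- f"] by (simp add: eq_neg_iff_add_eq_0 add.commute)


section \<open>The Burau representation\<close>

type_synonym 'a laurent_mat3 = "'a laurent ^ 3 ^ 3"

fun burau_gen :: "braid_gen \<Rightarrow> 'a::comm_ring_1 laurent_mat3" where
  "burau_gen Sigma1 = vector [vector [1 - lt, lt, 0],
                              vector [1, 0, 0],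
                              vector [0, 0, 1]]"
| "burau_gen Sigma2 = vector [vector [1, 0, 0],
                              vector [0, 1 - lt, lt],
                              vector [0, 1, 0]]"

fun burau_letter :: "braid_gen \<times> bool \<Rightarrow> 'a::comm_ring_1 laurent_mat3" where
  "burau_letter (s, e) = (if e then burau_gen s else matrix_inv (burau_gen s))"

fun burau_word :: "braid_word \<Rightarrow> 'a::comm_ring_1 laurent_mat3" where
  "burau_word [] = mat 1"
| "burau_word (a # w) = burau_letter a ** burau_word w"

lemma invertible_burau_gen: "invertible (burau_gen s :: 'a::comm_ring_1 laurent_mat3)"
proof (cases s)
  case Sigma1
  let ?B = "vector [vector [0, 1, 0], vector [lt_inv, 1 - lt_inv, 0], vector [0, 0, 1]]
    :: 'a laurent_mat3"
  have "burau_gen s ** ?B = mat 1" "?B ** burau_gen s = mat 1"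
    by (simp_all add: Sigma1 vec_eq_iff forall_3 matrix_matrix_mult_def sum_3 mat_def algebra_simps)
  then show ?thesis unfolding invertible_def by blast
next
  case Sigma2
  let ?B = "vector [vector [1, 0, 0], vector [0, 0, 1], vector [0, lt_inv, 1 - lt_inv]]
    :: 'a laurent_mat3"
  have "burau_gen s ** ?B = mat 1" "?B ** burau_gen s = mat 1"
    by (simp_all add: Sigma2 vec_eq_iff forall_3 matrix_matrix_mult_def sum_3 mat_def algebra_simps)
  then show ?thesis unfolding invertible_def by blast
qed

lemma matrix_inv_mult:
  assumes "invertible (A :: 'a::comm_ring_1 ^ 'n ^ 'n)"
  shows "A ** matrix_inv A = mat 1" "matrix_inv A ** A = mat 1"
proof -
  have "A ** matrix_inv A = mat 1 \<and> matrix_inv A ** A = mat 1"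
    using assms unfolding invertible_def matrix_inv_def by (rule someI_ex)
  then show "A ** matrix_inv A = mat 1" "matrix_inv A ** A = mat 1" by auto
qed

lemma burau_word_append: "burau_word (u @ w) = burau_word u ** burau_word w"
  by (induction u) (simp_all add: matrix_mul_assoc)

lemma burau_cancel: "burau_word [(s, e), (s, \<not> e)] = mat 1"
  using matrix_inv_mult[OF invertible_burau_gen[of s]] by (cases e) simp_all

lemma burau_rel:
  "burau_word [(Sigma1, True), (Sigma2, True), (Sigma1, True)]
     = burau_word [(Sigma2, True), (Sigma1, True), (Sigma2, True)]"
  by (simp add: vec_eq_iff forall_3 matrix_matrix_mult_def sum_3 mat_def algebra_simps)

lift_definition burau :: "braid3 \<Rightarrow> 'a::comm_ring_1 laurent_mat3" is burau_word
proof -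
  fix u w assume "braid_eq u w"
  then show "burau_word u = (burau_word w :: 'a laurent_mat3)"
    by induction
      (simp_all only: burau_word_append burau_cancel burau_rel matrix_mul_lid matrix_mul_rid)
qed


section \<open>The target group\<close>

definition burau_v :: "'a::comm_ring_1 laurent ^ 3" where
  "burau_v = vector [lt, lt ^ 2, lt ^ 3]"

definition J3 :: "'a::comm_ring_1 laurent_mat3" where
  "J3 = vector [vector [1, - lt_inv, - lt_inv],
                vector [- lt, 1, - lt_inv],
                vector [- lt, - lt, 1]]"

definition perm_matrices :: "('a::comm_ring_1 ^ 'n ^ 'n) set" where
  "perm_matrices = {P. \<exists>\<pi>. \<pi> permutes UNIV \<and> P = (\<chi> i j. if j = \<pi> i then 1 else 0)}"

text \<open>Everything here is defined over an arbitrary commutative ring. The prime field of order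
  \<open>p\<close> is the instance \<open>'p mod_ring\<close>, where \<open>'p :: prime_card\<close> is a type with \<open>p\<close> elements.
  In \<open>A *v 1 = 1\<close> the symbol \<open>1\<close> is the componentwise unit, i.e. the column vector of ones.\<close>

definition Gamma3 :: "'a::comm_ring_1 laurent_mat3 monoid" where
  "Gamma3 = \<lparr>carrier = {A. invertible A \<and> burau_v v* A = burau_v \<and> A *v 1 = 1 \<and>
                           map_matrix laurent_bar A ** J3 ** transpose A = J3 \<and>
                           map_matrix laurent_at_1 A \<in> perm_matrices},
             monoid.mult = (**), one = mat 1\<rparr>"

definition group_center :: "('a, 'b) monoid_scheme \<Rightarrow> 'a set" where
  "group_center G = {z \<in> carrier G. \<forall>x\<in>carrier G. z \<otimes>\<^bsub>G\<^esub> x = x \<otimes>\<^bsub>G\<^esub> z}"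

definition Gamma3_bar :: "'a::comm_ring_1 laurent_mat3 set monoid" where
  "Gamma3_bar = Gamma3 Mod group_center Gamma3"

definition q3 :: "'a::comm_ring_1 laurent_mat3 \<Rightarrow> 'a laurent_mat3 set" where
  "q3 A = group_center Gamma3 #>\<^bsub>Gamma3\<^esub> A"

lemma perm_matrix_mult:
  fixes \<pi> \<rho> :: "'n \<Rightarrow> 'n::finite"
  shows "(\<chi> i j. if j = \<pi> i then 1 else 0) ** (\<chi> i j. if j = \<rho> i then 1 else 0)
           = (\<chi> i j. if j = (\<rho> \<circ> \<pi>) i then 1 else (0::'a::comm_ring_1))"
  by (simp add: vec_eq_iff matrix_matrix_mult_def if_distrib[of "\<lambda>x. x * _"] cong: if_cong)

lemma map_matrix_mult:
  fixes f :: "'a::comm_ring_1 \<Rightarrow> 'b::comm_ring_1"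
  assumes "\<And>x y. f (x * y) = f x * f y"
    and "\<And>(g :: 'n \<Rightarrow> 'a) S. f (sum g S) = (\<Sum>i\<in>S. f (g i))"
  shows "map_matrix f (A ** B) = map_matrix f (A :: 'a ^ 'n ^ 'n) ** map_matrix f (B :: 'a ^ 'n ^ 'n)"
  by (simp add: vec_eq_iff matrix_matrix_mult_def assms)

lemmas map_matrix_bar_mult = map_matrix_mult[of laurent_bar, OF laurent_bar_mult laurent_bar_sum]
lemmas map_matrix_at_1_mult = map_matrix_mult[of laurent_at_1, OF laurent_at_1_mult laurent_at_1_sum]

lemma map_matrix_mat_1: "f 0 = 0 \<Longrightarrow> f 1 = 1 \<Longrightarrow> map_matrix f (mat 1) = mat 1"
  by (simp add: vec_eq_iff mat_def)

lemma mat_1_perm: "mat 1 = (\<chi> i j. if j = id i then 1 else (0::'a::comm_ring_1))"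
  by (auto simp: vec_eq_iff mat_def)

lemma vector_matrix_mul_assoc': "(x v* A) v* B = x v* (A ** (B :: 'a::comm_ring_1 ^ 'n ^ 'n))"
  unfolding vector_matrix_mult_def matrix_matrix_mult_def
  by (simp add: vec_eq_iff sum_distrib_left sum_distrib_right mult_ac) (subst sum.swap, simp)

lemma vector_matrix_mat_1: "x v* (mat 1 :: 'a::comm_ring_1 ^ 'n ^ 'n) = x"
  unfolding vector_matrix_mult_def mat_def
  by (simp add: vec_eq_iff if_distrib[of "\<lambda>x. _ * x"] cong: if_cong)

lemma transpose_mult: "transpose (A ** B) = transpose B ** transpose (A :: 'a::comm_ring_1 ^ 'n ^ 'n)"
  by (rule matrix_transpose_mul)

lemma carrier_Gamma3_mult:
  assumes "A \<in> carrier Gamma3" "B \<in> carrier Gamma3"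
  shows "A ** B \<in> carrier Gamma3"
proof -
  note A = assms(1)[unfolded Gamma3_def, simplified]
  note B = assms(2)[unfolded Gamma3_def, simplified]
  have "map_matrix laurent_bar (A ** B) ** J3 ** transpose (A ** B)
      = map_matrix laurent_bar A ** (map_matrix laurent_bar B ** J3 ** transpose B) ** transpose A"
    by (simp only: map_matrix_bar_mult transpose_mult matrix_mul_assoc)
  also have "\<dots> = J3" using A B by simp
  finally have J: "map_matrix laurent_bar (A ** B) ** J3 ** transpose (A ** B) = J3" .
  obtain \<pi> \<rho> where \<pi>: "\<pi> permutes UNIV" "\<rho> permutes UNIV"
    "map_matrix laurent_at_1 A = (\<chi> i j. if j = \<pi> i then 1 else 0)"
    "map_matrix laurent_at_1 B = (\<chi> i j. if j = \<rho> i then 1 else 0)"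
    using A B unfolding perm_matrices_def by blast
  then have P: "map_matrix laurent_at_1 (A ** B) \<in> perm_matrices"
    unfolding perm_matrices_def map_matrix_at_1_mult
    using permutes_compose[OF \<pi>(1,2)] by (auto simp only: perm_matrix_mult)
  have "burau_v v* (A ** B) = burau_v" "(A ** B) *v 1 = 1"
    using A B by (simp_all flip: vector_matrix_mul_assoc' matrix_vector_mul_assoc)
  with J P A B show ?thesis by (simp add: Gamma3_def invertible_mult)
qed

lemma carrier_Gamma3_one: "mat 1 \<in> carrier Gamma3"
proof -
  have "map_matrix laurent_at_1 (mat 1 :: 'a laurent_mat3) \<in> perm_matrices"
    unfolding perm_matrices_def using mat_1_perm permutes_id
    by (simp only: map_matrix_mat_1 laurent_at_1_0 laurent_at_1_1 mem_Collect_eq) blast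
  moreover have "invertible (mat 1 :: 'a laurent_mat3)"
    unfolding invertible_def using matrix_mul_lid by blast
  ultimately show ?thesis
    by (simp add: Gamma3_def map_matrix_mat_1 transpose_mat vector_matrix_mat_1)
qed

lemma carrier_Gamma3_inv:
  fixes A :: "'a::comm_ring_1 laurent_mat3"
  assumes "A \<in> carrier Gamma3"
  shows "matrix_inv A \<in> carrier Gamma3"
proof -
  note A = assms[unfolded Gamma3_def, simplified]
  let ?I = "matrix_inv A"
  have I: "A ** ?I = mat 1" "?I ** A = mat 1" using A matrix_inv_mult by auto
  have inv: "invertible ?I" using I unfolding invertible_def by blast
  have "burau_v v* ?I = (burau_v v* A) v* ?I" "?I *v 1 = ?I *v (A *v 1)" using A by simp_all
  then have v: "burau_v v* ?I = burau_v" "?I *v 1 = 1"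
    by (simp_all only: vector_matrix_mul_assoc' matrix_vector_mul_assoc I
        vector_matrix_mat_1 matrix_vector_mul_lid)
  have bI: "map_matrix laurent_bar ?I ** map_matrix laurent_bar A = mat 1"
    by (simp add: I map_matrix_mat_1 flip: map_matrix_bar_mult)
  have tI: "transpose A ** transpose ?I = mat 1"
    by (simp add: I flip: transpose_mult)
  have "map_matrix laurent_bar ?I ** J3 ** transpose ?I
      = map_matrix laurent_bar ?I ** (map_matrix laurent_bar A ** J3 ** transpose A) ** transpose ?I"
    using A by simp
  also have "\<dots> = (map_matrix laurent_bar ?I ** map_matrix laurent_bar A) ** J3
                 ** (transpose A ** transpose ?I)"
    by (simp only: matrix_mul_assoc)
  also have "\<dots> = J3" by (simp add: bI tI)
  finally have J: "map_matrix laurent_bar ?I ** J3 ** transpose ?I = J3" .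
  obtain \<pi> where \<pi>: "\<pi> permutes UNIV"
    and A1: "map_matrix laurent_at_1 A = (\<chi> i j. if j = \<pi> i then 1 else 0)"
    using A unfolding perm_matrices_def by blast
  let ?P = "(\<chi> i j. if j = inv_into UNIV \<pi> i then 1 else 0) :: 'a ^ 3 ^ 3"
  have "map_matrix laurent_at_1 A ** ?P = mat 1"
    unfolding A1 perm_matrix_mult mat_1_perm using permutes_inv_o(2)[OF \<pi>] by simp
  then have "map_matrix laurent_at_1 ?I = map_matrix laurent_at_1 ?I ** (map_matrix laurent_at_1 A ** ?P)"
    by simp
  also have "\<dots> = map_matrix laurent_at_1 (?I ** A) ** ?P"
    by (simp only: map_matrix_at_1_mult matrix_mul_assoc)
  also have "\<dots> = ?P" by (simp add: I map_matrix_mat_1)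
  finally have "map_matrix laurent_at_1 ?I = ?P" .
  with permutes_inv[OF \<pi>] have "map_matrix laurent_at_1 ?I \<in> perm_matrices"
    unfolding perm_matrices_def by blast
  with J v inv show ?thesis by (simp add: Gamma3_def)
qed

lemma group_Gamma3: "group (Gamma3 :: 'a::comm_ring_1 laurent_mat3 monoid)"
proof (rule groupI)
  fix A :: "'a laurent_mat3" assume A: "A \<in> carrier Gamma3"
  then have "matrix_inv A ** A = mat 1" by (simp add: Gamma3_def matrix_inv_mult)
  with carrier_Gamma3_inv[OF A] show "\<exists>B\<in>carrier Gamma3. B \<otimes>\<^bsub>Gamma3\<^esub> A = \<one>\<^bsub>Gamma3\<^esub>"
    by (auto simp: Gamma3_def)
next
  fix A B :: "'a laurent_mat3" assume "A \<in> carrier Gamma3" "B \<in> carrier Gamma3"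
  then show "A \<otimes>\<^bsub>Gamma3\<^esub> B \<in> carrier Gamma3"
    using carrier_Gamma3_mult[of A B] by (simp add: Gamma3_def)
next
  show "\<one>\<^bsub>Gamma3\<^esub> \<in> carrier (Gamma3 :: 'a laurent_mat3 monoid)"
    using carrier_Gamma3_one by (simp add: Gamma3_def)
qed (simp_all add: Gamma3_def matrix_mul_assoc)

lemma burau_gen_Gamma3: "burau_gen s \<in> carrier (Gamma3 :: 'a::comm_ring_1 laurent_mat3 monoid)"
proof -
  have lt: "laurent_bar lt = lt_inv" "laurent_at_1 lt = 1"
    by (simp_all add: lt_def lt_inv_def laurent_bar_single laurent_at_1_single)
  have lt': "lt * (lt_inv * x) = x" "lt_inv * (lt * x) = x" for x :: "'a laurent"
    by (simp_all flip: mult.assoc)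
  have diff: "laurent_bar (1 - lt) = 1 - lt_inv" "laurent_at_1 (1 - lt) = 0"
    by (simp_all only: diff_conv_add_uminus laurent_bar_add laurent_at_1_add laurent_bar_uminus
        laurent_at_1_uminus laurent_bar_1 laurent_at_1_1 lt) simp_all
  define \<pi> :: "3 \<Rightarrow> 3" where "\<pi> = (case s of Sigma1 \<Rightarrow> Transposition.transpose 1 2
    | Sigma2 \<Rightarrow> Transposition.transpose 2 3)"
  have "\<pi> permutes UNIV"
    unfolding \<pi>_def by (cases s) (auto intro: permutes_swap_id)
  moreover have "map_matrix laurent_at_1 (burau_gen s) = (\<chi> i j. if j = \<pi> i then 1 else (0::'a))"
    by (cases s) (simp_all add: \<pi>_def vec_eq_iff forall_3 lt diff Transposition.transpose_def)
  ultimately have "map_matrix laurent_at_1 (burau_gen s :: 'a laurent_mat3) \<in> perm_matrices"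
    unfolding perm_matrices_def by blast
  moreover have "burau_v v* burau_gen s = (burau_v :: 'a laurent ^ 3)"
    by (cases s) (simp_all add: burau_v_def vec_eq_iff forall_3 sum_3 vector_matrix_mult_def
        algebra_simps power2_eq_square power3_eq_cube)
  moreover have "burau_gen s *v 1 = (1 :: 'a laurent ^ 3)"
    by (cases s) (simp_all add: vec_eq_iff forall_3 sum_3 matrix_vector_mult_def)
  moreover have "map_matrix laurent_bar (burau_gen s) ** J3 ** Finite_Cartesian_Product.transpose (burau_gen s)
      = (J3 :: 'a laurent_mat3)"
  proof (cases s)
    case Sigma1
    show ?thesis
      by (simp add: Sigma1 J3_def vec_eq_iff forall_3 sum_3 matrix_matrix_mult_def
          Finite_Cartesian_Product.transpose_def lt diff)
        (simp add: distrib_left distrib_right left_diff_distrib right_diff_distrib lt' mult.assoc)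
  next
    case Sigma2
    show ?thesis
      by (simp add: Sigma2 J3_def vec_eq_iff forall_3 sum_3 matrix_matrix_mult_def
          Finite_Cartesian_Product.transpose_def lt diff)
        (simp add: distrib_left distrib_right left_diff_distrib right_diff_distrib lt' mult.assoc)
  qed
  ultimately show ?thesis
    using invertible_burau_gen[of s, where 'a = 'a] by (simp add: Gamma3_def)
qed

lemma burau_hom: "burau \<in> hom B3 (Gamma3 :: 'a::comm_ring_1 laurent_mat3 monoid)"
proof (rule homI)
  have letter: "burau_letter a \<in> carrier (Gamma3 :: 'a laurent_mat3 monoid)" for a
    by (cases a) (simp add: burau_gen_Gamma3 carrier_Gamma3_inv)
  have word: "burau_word w \<in> carrier (Gamma3 :: 'a laurent_mat3 monoid)" for w
    by (induction w) (simp_all add: letter carrier_Gamma3_one carrier_Gamma3_mult)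
  show "burau x \<in> carrier (Gamma3 :: 'a laurent_mat3 monoid)" for x
    by transfer (rule word)
  have "burau (braid_mult x y) = (burau x ** burau y :: 'a laurent_mat3)" for x y
    by transfer (rule burau_word_append)
  then show "burau (x \<otimes>\<^bsub>B3\<^esub> y) = burau x \<otimes>\<^bsub>Gamma3\<^esub> (burau y :: 'a laurent_mat3)" for x y
    by (simp add: B3_def Gamma3_def)
qed

lemma (in group) normal_center: "group_center G \<lhd> G"
proof (rule normal_invI)
  show "subgroup (group_center G) G"
  proof (rule subgroupI)
    fix a assume a: "a \<in> group_center G"
    then have "a \<in> carrier G" by (simp add: group_center_def)
    moreover have "inv a \<otimes> x = x \<otimes> inv a" if x: "x \<in> carrier G" for x
    proof -
      have ac: "a \<in> carrier G" and c: "x \<otimes> a = a \<otimes> x" using a x by (auto simp: group_center_def)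
      have "inv a \<otimes> x = inv a \<otimes> (x \<otimes> a) \<otimes> inv a" using ac x by (simp add: m_assoc)
      also have "\<dots> = inv a \<otimes> a \<otimes> (x \<otimes> inv a)" unfolding c using ac x by (simp only: m_assoc inv_closed m_closed)
      also have "\<dots> = x \<otimes> inv a" using ac x by simp
      finally show ?thesis .
    qed
    ultimately show "inv a \<in> group_center G" by (simp add: group_center_def)
  next
    fix a b assume ab: "a \<in> group_center G" "b \<in> group_center G"
    then have abc: "a \<in> carrier G" "b \<in> carrier G" by (auto simp: group_center_def)
    have "a \<otimes> b \<otimes> x = x \<otimes> (a \<otimes> b)" if x: "x \<in> carrier G" for x
    proof -
      have c: "a \<otimes> x = x \<otimes> a" "b \<otimes> x = x \<otimes> b" using ab x by (auto simp: group_center_def)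
      have "a \<otimes> b \<otimes> x = a \<otimes> x \<otimes> b" using abc x by (simp add: m_assoc c(2))
      then show ?thesis unfolding c(1) using abc x by (simp add: m_assoc)
    qed
    with abc show "a \<otimes> b \<in> group_center G" by (simp add: group_center_def)
  qed (auto simp: group_center_def)
next
  fix x h assume x: "x \<in> carrier G" and h: "h \<in> group_center G"
  then have "h \<in> carrier G" "x \<otimes> h = h \<otimes> x" by (auto simp: group_center_def)
  then have "x \<otimes> h \<otimes> inv x = h" using x by (simp add: m_assoc)
  with h show "x \<otimes> h \<otimes> inv x \<in> group_center G" by simp
qed

lemma q3_hom: "q3 \<in> hom Gamma3 (Gamma3_bar :: 'a::comm_ring_1 laurent_mat3 set monoid)"
  using normal.r_coset_hom_Mod[OF group.normal_center[OF group_Gamma3]]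
  unfolding Gamma3_bar_def q3_def by (simp add: eta_contract_eq)

lemma q3_burau_hom: "q3 \<circ> burau \<in> hom B3 (Gamma3_bar :: 'a::comm_ring_1 laurent_mat3 set monoid)"
  using hom_compose[OF burau_hom q3_hom] .

end

theory Submission
  imports Defs
begin

text \<open>
  Both halves are about one tree. A matrix that fixes the column \<open>1\<close> acts on the row vectors with
  coordinate sum zero, a free module with basis \<open>(1, -1, 0)\<close>, \<open>(0, t, -t)\<close>; call its \<open>2 \<times> 2\<close>
  matrix there the reduced matrix. In this basis \<open>\<sigma>\<^sub>1\<sigma>\<^sub>2\<close> becomes \<open>t\<close> times a constant matrix \<open>rot\<close> of
  order 3, and \<open>\<sigma>\<^sub>1\<sigma>\<^sub>2\<sigma>\<^sub>1\<close> becomes \<open>-t\<close> times a matrix \<open>flip\<close> with square \<open>t\<close>. So up to scalars the image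
  of the braid group is generated by \<open>rot\<close> and \<open>flip\<close>. On the target group, taking reduced matrices is
  injective and the center consists of the elements with scalar reduced matrix. Hence the quotient
  by the center only sees reduced matrices up to scalars.

  Over the field of Laurent series in \<open>1/t\<close>, such matrices act on a tree in which the neighbors of the
  standard vertex correspond to the \<open>p + 1\<close> lines in the plane over the prime field. Take the
  coefficient matrix of \<open>g\<close> at the highest exponent that occurs in \<open>g\<close>. If it is invertible, \<open>g\<close> fixes the
  standard vertex; if it has rank one, its column space is the line along which the path from the
  standard vertex to its image under \<open>g\<close> starts. In this language \<open>rot\<close> fixes the standard vertex and
  permutes the lines spanned by \<open>(0,1)\<close>, \<open>(1,0)\<close>, \<open>(1,-1)\<close>, and \<open>flip\<close> inverts the edge along \<open>(0,1)\<close>. A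
  normal form for words in \<open>rot\<close> and \<open>flip\<close> shows that no element of the image starts along any other line
  (\<open>lead_burau_admissible\<close>).

  For \<open>p = 2\<close> these three lines are all lines. Any unitary reduced matrix can therefore be shortened by
  a power of \<open>rot\<close> followed by the inverse of \<open>flip\<close>, until its leading matrix is invertible. At that
  point unitarity, which couples the highest exponent with the lowest one, leaves only a scalar times a
  constant isometry, and over the field with two elements the isometries are the powers of \<open>rot\<close>
  (\<open>unitary_realizable\<close>).

  For \<open>p > 2\<close> the line spanned by \<open>(1,1)\<close> is a further one. The unitary reflections
  \<open>1 + f \<cdot> col \<cdot> row\<close>, with row the image of \<open>(1, -1, 0)\<close> under \<open>1 + 2 rot\<close>, start along it as soon as \<open>f\<close> has
  positive degree (\<open>reflection_not_in_image\<close>). If \<open>p \<noteq> 3\<close>, then \<open>1 + 2 rot\<close> has square \<open>-3\<close>, and conjugating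
  \<open>\<sigma>\<^sub>1\<^sup>2\<close> by it gives a reflection in the target group all of whose positive powers start along \<open>(1,1)\<close>. If
  \<open>p = 3\<close>, the reflections are transvections that form an infinite elementary abelian group. Either way
  there are infinitely many of them whose quotients avoid the image times the center, so they lie in
  different cosets.
\<close>

section \<open>Degrees of Laurent polynomials\<close>

text \<open>An upper bound on the degree, so that zero and cancellation of top terms need no special
  treatment.\<close>
definition deg_le :: "'a::comm_ring_1 laurent \<Rightarrow> int \<Rightarrow> bool" where
  "deg_le f n \<longleftrightarrow> (\<forall>k>n. Poly_Mapping.lookup f k = 0)"

lemma lookup_mult_eq_sum:
  fixes f g :: "'a::comm_ring_1 laurent"
  shows "Poly_Mapping.lookup (f * g) n
    = (\<Sum>k\<in>Poly_Mapping.keys f. Poly_Mapping.lookup f k * Poly_Mapping.lookup g (n - k))"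
proof -
  have single: "Poly_Mapping.lookup (Poly_Mapping.single k c * g) n
      = c * Poly_Mapping.lookup g (n - k)" for k c
    by (induction g rule: laurent_induct)
      (auto simp: mult_single lookup_single when_def distrib_left lookup_add)
  have "f * g = (\<Sum>k\<in>Poly_Mapping.keys f. Poly_Mapping.single k (Poly_Mapping.lookup f k) * g)"
    unfolding sum_distrib_right[symmetric]
    by (rule arg_cong[where f = "\<lambda>h. h * g"], rule poly_mapping_eqI)
      (auto simp: lookup_sum lookup_single when_def in_keys_iff)
  then show ?thesis
    by (simp add: lookup_sum single)
qed

lemma deg_le_mult:
  assumes "deg_le f m" "deg_le g n"
  shows "deg_le (f * g) (m + n)"
  unfolding deg_le_def
proof (intro allI impI)
  fix k assume k: "m + n < k"
  have "Poly_Mapping.lookup f i * Poly_Mapping.lookup g (k - i) = 0" for i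
    using assms k by (cases "i > m") (auto simp: deg_le_def)
  then show "Poly_Mapping.lookup (f * g) k = 0"
    by (simp add: lookup_mult_eq_sum)
qed

lemma lookup_mult_top:
  assumes "deg_le f m" "deg_le g n"
  shows "Poly_Mapping.lookup (f * g) (m + n) = Poly_Mapping.lookup f m * Poly_Mapping.lookup g n"
proof -
  have "Poly_Mapping.lookup f i * Poly_Mapping.lookup g (m + n - i) = 0" if "i \<noteq> m" for i
    using assms that by (cases "i > m") (auto simp: deg_le_def)
  then have "Poly_Mapping.lookup (f * g) (m + n)
      = (\<Sum>i\<in>Poly_Mapping.keys f \<inter> {m}. Poly_Mapping.lookup f i * Poly_Mapping.lookup g (m + n - i))"
    unfolding lookup_mult_eq_sum by (intro sum.mono_neutral_right) auto
  then show ?thesis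
    by (cases "m \<in> Poly_Mapping.keys f") (auto simp: in_keys_iff)
qed

lemma deg_le_mono: "deg_le f m \<Longrightarrow> m \<le> n \<Longrightarrow> deg_le f n"
  by (simp add: deg_le_def)

lemma deg_le_zero [simp]: "deg_le 0 n"
  by (simp add: deg_le_def)

lemma deg_le_add: "deg_le f n \<Longrightarrow> deg_le g n \<Longrightarrow> deg_le (f + g) n"
  by (simp add: deg_le_def lookup_add)

lemma deg_le_uminus: "deg_le f n \<Longrightarrow> deg_le (- f) n"
  by (simp add: deg_le_def)

lemma deg_le_sum: "(\<And>i. i \<in> S \<Longrightarrow> deg_le (f i) n) \<Longrightarrow> deg_le (sum f S) n"
  by (simp add: deg_le_def lookup_sum)

lemma exists_deg_le: "\<exists>n. deg_le f n"
proof -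
  have "deg_le f (Max (insert 0 (Poly_Mapping.keys f)))"
    unfolding deg_le_def
    by (metis Max_ge finite_insert finite_keys in_keys_iff insertCI not_le)
  then show ?thesis ..
qed

lemma exists_degree:
  assumes "f \<noteq> 0"
  obtains n where "deg_le f n" "Poly_Mapping.lookup f n \<noteq> 0"
proof
  have ne: "Poly_Mapping.keys f \<noteq> {}" using assms by simp
  show "Poly_Mapping.lookup f (Max (Poly_Mapping.keys f)) \<noteq> 0"
    using Max_in[OF finite_keys ne] by (simp add: in_keys_iff)
  show "deg_le f (Max (Poly_Mapping.keys f))"
    unfolding deg_le_def by (metis Max_ge finite_keys in_keys_iff not_le)
qed

text \<open>The matrix \<open>L\<close> may be zero, so that \<open>n\<close> is again only an upper bound; when \<open>L \<noteq> 0\<close>, both \<open>n\<close> and \<open>L\<close>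
  are determined by \<open>A\<close> (\<open>lead_unique\<close>). Leading matrices multiply, even if the product of two nonzero ones
  happens to be zero.\<close>
definition lead :: "'a::comm_ring_1 laurent ^ 'n ^ 'm \<Rightarrow> int \<Rightarrow> 'a ^ 'n ^ 'm \<Rightarrow> bool" where
  "lead A n L \<longleftrightarrow> (\<forall>i j. deg_le (A $ i $ j) n \<and> Poly_Mapping.lookup (A $ i $ j) n = L $ i $ j)"

lemma lead_mult:
  fixes A :: "'a::comm_ring_1 laurent ^ 'n ^ 'm" and B :: "'a laurent ^ 'k ^ 'n"
  assumes "lead A m L" "lead B n M"
  shows "lead (A ** B) (m + n) (L ** M)"
  unfolding lead_def matrix_matrix_mult_def using assms
  by (auto simp: lead_def lookup_sum lookup_mult_top intro!: deg_le_sum deg_le_mult)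

lemma lead_unique:
  assumes A: "lead A m L" "L \<noteq> 0" and B: "lead A n M" "M \<noteq> 0"
  shows "m = n \<and> L = M"
proof -
  obtain i j i' j' where L: "L $ i $ j \<noteq> 0" and M: "M $ i' $ j' \<noteq> 0"
    using assms by (metis vec_eq_iff zero_index)
  have "m = n"
  proof (rule linorder_cases[of m n])
    assume "m < n"
    then show ?thesis using A(1) B(1) M unfolding lead_def deg_le_def by metis
  next
    assume "n < m"
    then show ?thesis using A(1) B(1) L unfolding lead_def deg_le_def by metis
  qed
  with A(1) B(1) show ?thesis by (auto simp: lead_def vec_eq_iff)
qed

lemma lead_mat:
  assumes "deg_le f n" "Poly_Mapping.lookup f n = c"
  shows "lead (mat f) n (mat c)"
  using assms by (simp add: lead_def mat_def)

lemma exists_lead: "\<exists>n L. lead (A :: 'a::comm_ring_1 laurent ^ 'n ^ 'm) n L"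
proof -
  have "\<forall>ij. \<exists>n. deg_le (A $ fst ij $ snd ij) n" by (simp add: exists_deg_le)
  then obtain d where d: "\<And>i j. deg_le (A $ i $ j) (d (i, j))"
    by (metis fst_conv snd_conv)
  have "deg_le (A $ i $ j) (Max (range d))" for i j
    by (rule deg_le_mono[OF d]) simp
  then have "lead A (Max (range d)) (\<chi> i j. Poly_Mapping.lookup (A $ i $ j) (Max (range d)))"
    by (simp add: lead_def)
  then show ?thesis by blast
qed

section \<open>The reduced representation\<close>

lemma lt_cancel [simp]: "lt * (lt_inv * f) = f" "lt_inv * (lt * f) = f"
  by (simp_all flip: mult.assoc)

lemma lt_nonzero: "lt \<noteq> (0 :: 'a::comm_ring_1 laurent)"
  by (metis lt_lt_inv(1) mult_zero_left zero_neq_one)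

lemma lookup_lt: "Poly_Mapping.lookup lt k = (if k = 1 then 1 else 0)"
  and lookup_lt_inv: "Poly_Mapping.lookup lt_inv k = (if k = -1 then 1 else 0)"
  and lookup_one_laurent: "Poly_Mapping.lookup (1 :: 'a::comm_ring_1 laurent) k = (if k = 0 then 1 else 0)"
  by (auto simp: lt_def lt_inv_def lookup_single lookup_one when_def)

lemma laurent_bar_lt [simp]: "laurent_bar lt = lt_inv" "laurent_bar lt_inv = lt"
  by (simp_all add: lt_def lt_inv_def laurent_bar_single)

lemma laurent_bar_diff: "laurent_bar (f - g) = laurent_bar f - laurent_bar g"
  by (simp only: diff_conv_add_uminus laurent_bar_add laurent_bar_uminus)

lemma mat_mult_commute: "mat c ** A = A ** (mat c :: 'a::comm_ring_1 ^ 'n ^ 'n)"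
  by (simp add: vec_eq_iff matrix_matrix_mult_def mat_def if_distrib[of "\<lambda>x. x * _"]
      if_distrib[of "\<lambda>x. _ * x"] mult.commute cong: if_cong)

lemma mat_mult_mat: "mat a ** mat b = (mat (a * b) :: 'a::comm_ring_1 ^ 'n ^ 'n)"
  by (simp add: vec_eq_iff matrix_matrix_mult_def mat_def if_distrib[of "\<lambda>x. x * _"] cong: if_cong)

text \<open>The rows of \<open>diff_basis\<close> are the chosen basis of the row vectors with coordinate sum zero. The factor \<open>t\<close>
  in the second one is what makes the product of the two braid generators a scalar times a constant
  matrix.\<close>
definition diff_basis :: "'a::comm_ring_1 laurent ^ 3 ^ 2" where
  "diff_basis = vector [vector [1, -1, 0], vector [0, lt, - lt]]"

text \<open>A right inverse of \<open>diff_basis\<close>: it reads off the coordinates of a row vector with coordinate sum zero.\<close>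
definition diff_basis_section :: "'a::comm_ring_1 laurent ^ 2 ^ 3" where
  "diff_basis_section = vector [vector [1, 0], vector [0, 0], vector [0, - lt_inv]]"

definition reduced_mat :: "'a::comm_ring_1 laurent_mat3 \<Rightarrow> 'a laurent ^ 2 ^ 2" where
  "reduced_mat A = diff_basis ** A ** diff_basis_section"

lemma diff_basis_mult_section: "diff_basis ** diff_basis_section = mat 1"
  by (simp add: diff_basis_def diff_basis_section_def vec_eq_iff forall_2 matrix_matrix_mult_def sum_3 mat_def)

lemma row_sum_1:
  fixes A :: "'a::comm_ring_1 ^ 3 ^ 'n"
  shows "A *v 1 = 1 \<longleftrightarrow> (\<forall>i. A $ i $ 1 + A $ i $ 2 + A $ i $ 3 = 1)"
  by (simp add: vec_eq_iff matrix_vector_mult_def sum_3)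

lemma reduced_mult_diff_basis:
  assumes "A *v 1 = 1"
  shows "reduced_mat A ** diff_basis = diff_basis ** A"
proof -
  have second: "A $ i $ 2 = 1 - A $ i $ 1 - A $ i $ 3" for i
    using assms by (simp add: row_sum_1 algebra_simps)
  show ?thesis
    by (simp add: second reduced_mat_def diff_basis_def diff_basis_section_def vec_eq_iff forall_2 forall_3
        matrix_matrix_mult_def sum_3 sum_2 algebra_simps)
qed

lemma reduced_mult:
  assumes "A *v 1 = 1"
  shows "reduced_mat (A ** B) = reduced_mat A ** reduced_mat B"
proof -
  have "reduced_mat (A ** B) = diff_basis ** A ** B ** diff_basis_section"
    by (simp add: reduced_mat_def matrix_mul_assoc)
  also have "\<dots> = reduced_mat A ** diff_basis ** B ** diff_basis_section"
    by (simp add: reduced_mult_diff_basis[OF assms])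
  finally show ?thesis by (simp add: reduced_mat_def matrix_mul_assoc)
qed

lemma reduced_one: "reduced_mat (mat 1) = mat 1"
  by (simp add: reduced_mat_def diff_basis_mult_section)

text \<open>The reduced matrix gives the differences of consecutive rows. The condition \<open>v A = v\<close> fixes the
  combination \<open>t r\<^sub>1 + t\<^sup>2 r\<^sub>2 + t\<^sup>3 r\<^sub>3\<close> of the rows, and together they determine \<open>(t + t\<^sup>2 + t\<^sup>3) r\<^sub>3\<close>.\<close>
lemma reduced_inj:
  fixes A B :: "'a::idom laurent_mat3"
  assumes A: "burau_v v* A = burau_v" "A *v 1 = 1"
    and B: "burau_v v* B = burau_v" "B *v 1 = 1"
    and eq: "reduced_mat A = reduced_mat B"
  shows "A = B"
proof -
  have "diff_basis ** A = diff_basis ** B"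
    using reduced_mult_diff_basis[OF A(2)] reduced_mult_diff_basis[OF B(2)] eq by metis
  then have d: "A $ 1 $ j - A $ 2 $ j = B $ 1 $ j - B $ 2 $ j"
      "lt * A $ 2 $ j - lt * A $ 3 $ j = lt * B $ 2 $ j - lt * B $ 3 $ j" for j
    by (simp_all add: diff_basis_def vec_eq_iff forall_2 matrix_matrix_mult_def sum_3)
  have d2: "A $ 2 $ j - A $ 3 $ j = B $ 2 $ j - B $ 3 $ j" for j
    using d(2)[of j] lt_nonzero[where 'a = 'a] by (simp flip: right_diff_distrib)
  have v: "A $ 1 $ j * lt + A $ 2 $ j * lt ^ 2 + A $ 3 $ j * lt ^ 3
      = B $ 1 $ j * lt + B $ 2 $ j * lt ^ 2 + B $ 3 $ j * lt ^ 3" for j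
    using A(1) B(1) unfolding vector_matrix_mult_def vec_eq_iff burau_v_def
    by (simp add: sum_3 mult.commute)
  have "Poly_Mapping.lookup (lt + lt ^ 2 + lt ^ 3 :: 'a laurent) 1 = 1"
    by (simp add: lt_def lookup_add power2_eq_square power3_eq_cube mult_single lookup_single)
  then have nz: "lt + lt ^ 2 + lt ^ 3 \<noteq> (0 :: 'a laurent)" by auto
  have third: "A $ 3 $ j = B $ 3 $ j" for j
  proof -
    have "(lt + lt ^ 2 + lt ^ 3) * (A $ 3 $ j - B $ 3 $ j)
        = (A $ 1 $ j * lt + A $ 2 $ j * lt ^ 2 + A $ 3 $ j * lt ^ 3
            - (B $ 1 $ j * lt + B $ 2 $ j * lt ^ 2 + B $ 3 $ j * lt ^ 3))
          - lt * (A $ 1 $ j - A $ 2 $ j - (B $ 1 $ j - B $ 2 $ j))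
          - (lt + lt ^ 2) * (A $ 2 $ j - A $ 3 $ j - (B $ 2 $ j - B $ 3 $ j))"
      by (simp add: algebra_simps power2_eq_square power3_eq_cube)
    also have "\<dots> = 0"
      unfolding v[of j] d(1)[of j] d2[of j] by simp
    finally have "(lt + lt ^ 2 + lt ^ 3) * (A $ 3 $ j - B $ 3 $ j) = 0" .
    with nz show ?thesis by simp
  qed
  have second: "A $ 2 $ j = B $ 2 $ j" for j using d2[of j] third[of j] by simp
  have "A $ 1 $ j = B $ 1 $ j" for j using d(1)[of j] second[of j] by simp
  with second third show ?thesis by (simp add: vec_eq_iff forall_3)
qed

definition rot :: "'a::comm_ring_1 ^ 2 ^ 2" where
  "rot = vector [vector [-1, -1], vector [1, 0]]"

definition flip :: "'a::comm_ring_1 laurent ^ 2 ^ 2" where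
  "flip = vector [vector [0, 1], vector [lt, 0]]"

lemma rot_cube: "rot ** (rot ** (rot ** A)) = (A :: 'a::comm_ring_1 ^ 'n ^ 2)"
  by (simp add: rot_def vec_eq_iff forall_2 matrix_matrix_mult_def sum_2)

lemma rot_cube_one: "rot ** (rot ** rot) = (mat 1 :: 'a::comm_ring_1 ^ 2 ^ 2)"
  using rot_cube[of "mat 1"] by simp

lemma flip_square: "flip ** (flip ** A) = mat lt ** (A :: 'a::comm_ring_1 laurent ^ 2 ^ 2)"
  by (simp add: flip_def vec_eq_iff forall_2 matrix_matrix_mult_def sum_2 mat_def)

lemma burau_gen_row_sum: "burau_gen s *v 1 = (1 :: 'a::comm_ring_1 laurent ^ 3)"
  using burau_gen_Gamma3[of s, where 'a = 'a] by (simp add: Gamma3_def)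

text \<open>The inverse of \<open>rot\<close> is its square, so up to scalars the two generators of the braid group are
  \<open>rot\<^sup>-\<^sup>1 flip\<close> and \<open>flip rot\<^sup>-\<^sup>1\<close>.\<close>
lemma reduced_Sigma1: "reduced_mat (burau_gen Sigma1) = mat (- 1) ** (rot ** (rot ** flip))"
  and reduced_Sigma2: "reduced_mat (burau_gen Sigma2) = mat (- 1) ** (flip ** (rot ** rot))"
  by (simp_all add: reduced_mat_def diff_basis_def diff_basis_section_def rot_def flip_def vec_eq_iff forall_2
      matrix_matrix_mult_def sum_2 sum_3 mat_def algebra_simps)

lemma reduced_matrix_inv:
  fixes A :: "'a::comm_ring_1 laurent_mat3"
  assumes "invertible A" "A *v 1 = 1" "reduced_mat A ** Y = mat 1"
  shows "reduced_mat (matrix_inv A) = Y"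
proof -
  have inv: "matrix_inv A ** A = mat 1" using assms(1) by (rule matrix_inv_mult)
  have "matrix_inv A *v 1 = matrix_inv A *v (A *v 1)" using assms(2) by simp
  then have one: "matrix_inv A *v 1 = 1" by (simp add: matrix_vector_mul_assoc inv)
  have "reduced_mat (matrix_inv A) = reduced_mat (matrix_inv A) ** (reduced_mat A ** Y)"
    using assms(3) by simp
  also have "\<dots> = reduced_mat (matrix_inv A ** A) ** Y"
    by (simp add: reduced_mult[OF one] matrix_mul_assoc)
  finally show ?thesis by (simp add: inv reduced_one)
qed

lemma reduced_letter:
  fixes a :: "braid_gen \<times> bool"
  obtains c M where "c \<noteq> 0" "reduced_mat (burau_letter a :: 'a::comm_ring_1 laurent_mat3) = mat c ** M"
    "M \<in> {rot ** (rot ** flip), flip ** (rot ** rot), flip ** rot, rot ** flip}"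
proof -
  obtain s e where a: "a = (s, e)" by force
  have "reduced_mat (burau_gen Sigma1) ** (mat (- lt_inv) ** (flip ** rot)) = (mat 1 :: 'a laurent ^ 2 ^ 2)"
    "reduced_mat (burau_gen Sigma2) ** (mat (- lt_inv) ** (rot ** flip)) = (mat 1 :: 'a laurent ^ 2 ^ 2)"
    unfolding reduced_Sigma1 reduced_Sigma2
    by (simp_all add: rot_def flip_def vec_eq_iff forall_2
      matrix_matrix_mult_def sum_2 sum_3 mat_def algebra_simps)
  then have inv: "reduced_mat (burau_letter (Sigma1, False)) = mat (- lt_inv :: 'a laurent) ** (flip ** rot)"
    "reduced_mat (burau_letter (Sigma2, False)) = mat (- lt_inv :: 'a laurent) ** (rot ** flip)"
    using reduced_matrix_inv[OF invertible_burau_gen burau_gen_row_sum]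
    by (simp_all del: burau_gen.simps)
  have gen: "reduced_mat (burau_letter (Sigma1, True)) = mat (- 1 :: 'a laurent) ** (rot ** (rot ** flip))"
    "reduced_mat (burau_letter (Sigma2, True)) = mat (- 1 :: 'a laurent) ** (flip ** (rot ** rot))"
    by (simp_all only: burau_letter.simps if_True reduced_Sigma1 reduced_Sigma2)
  have nz: "- lt_inv \<noteq> (0 :: 'a laurent)" "- 1 \<noteq> (0 :: 'a laurent)"
    by (metis lt_lt_inv(1) mult_zero_right neg_0_equal_iff_equal zero_neq_one, simp)
  show thesis
  proof (cases s; cases e)
    assume "s = Sigma1" "e"
    then show thesis using that[OF nz(2)] gen(1) a by simp
  next
    assume "s = Sigma1" "\<not> e"
    then show thesis using that[OF nz(1)] inv(1) a by simp
  next
    assume "s = Sigma2" "e"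
    then show thesis using that[OF nz(2)] gen(2) a by simp
  next
    assume "s = Sigma2" "\<not> e"
    then show thesis using that[OF nz(1)] inv(2) a by simp
  qed
qed

lemma burau_word_row_sum: "burau_word w *v 1 = (1 :: 'a::comm_ring_1 laurent ^ 3)"
  and burau_letter_row_sum: "burau_letter a *v 1 = (1 :: 'a::comm_ring_1 laurent ^ 3)"
proof -
  show letter: "burau_letter a *v 1 = (1 :: 'a laurent ^ 3)" for a
    using burau_gen_Gamma3 carrier_Gamma3_inv[OF burau_gen_Gamma3]
    by (cases a) (auto simp: Gamma3_def)
  show "burau_word w *v 1 = (1 :: 'a laurent ^ 3)"
    by (induction w) (simp_all add: letter flip: matrix_vector_mul_assoc)
qed

lemma burau_word_Gamma3: "burau_word w \<in> carrier (Gamma3 :: 'a::comm_ring_1 laurent_mat3 monoid)"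
proof (induction w)
  case (Cons a w)
  have "burau_letter a \<in> carrier (Gamma3 :: 'a laurent_mat3 monoid)"
    by (cases a) (simp add: burau_gen_Gamma3 carrier_Gamma3_inv)
  with Cons show ?case by (simp add: carrier_Gamma3_mult)
qed (simp add: carrier_Gamma3_one)

lemma range_burau: "range burau = range burau_word"
proof -
  have "\<exists>w. burau b = (burau_word w :: 'a::comm_ring_1 laurent_mat3)" for b
    by transfer blast
  moreover have "\<exists>b. burau_word w = (burau b :: 'a::comm_ring_1 laurent_mat3)" for w
    by (metis burau.abs_eq)
  ultimately show ?thesis by (auto simp: image_iff)
qed

section \<open>Normal forms in the reduced image\<close>

text \<open>Reduced words in the free product of a group of order 2 and a group of order 3, with the factor of
  order 2 in front. Factors \<open>t\<close> from the square of \<open>flip\<close> are dropped, which is why normal forms exist only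
  up to scalars.\<close>
inductive flip_led :: "'a::comm_ring_1 laurent ^ 2 ^ 2 \<Rightarrow> bool" where
  "flip_led flip"
| "flip_led (flip ** rot)"
| "flip_led (flip ** (rot ** rot))"
| "flip_led g \<Longrightarrow> flip_led (flip ** (rot ** g))"
| "flip_led g \<Longrightarrow> flip_led (flip ** (rot ** (rot ** g)))"

definition normal_form :: "'a::comm_ring_1 laurent ^ 2 ^ 2 \<Rightarrow> bool" where
  "normal_form g \<longleftrightarrow> g \<in> {mat 1, rot, rot ** rot} \<or>
     (\<exists>h. flip_led h \<and> g \<in> {h, rot ** h, rot ** (rot ** h)})"

definition normalizable :: "'a::comm_ring_1 laurent ^ 2 ^ 2 \<Rightarrow> bool" where
  "normalizable g \<longleftrightarrow> (\<exists>c h. c \<noteq> 0 \<and> normal_form h \<and> g = mat c ** h)"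

lemma normal_form_rot: "normal_form g \<Longrightarrow> normal_form (rot ** g)"
  unfolding normal_form_def by (auto simp: rot_cube rot_cube_one)

lemma scalar_left: "A ** (mat c ** B) = mat c ** (A ** (B :: 'a::comm_ring_1 ^ 'n ^ 'n))"
  by (metis mat_mult_commute matrix_mul_assoc)

lemma normalizable_scalar:
  fixes g :: "'a::idom laurent ^ 2 ^ 2"
  assumes "normalizable g" "c \<noteq> 0"
  shows "normalizable (mat c ** g)"
proof -
  obtain b h where "b \<noteq> 0" "normal_form h" "g = mat b ** h"
    using assms(1) unfolding normalizable_def by blast
  then have "c * b \<noteq> 0" "normal_form h" "mat c ** g = mat (c * b) ** h"
    using assms(2) by (simp_all add: matrix_mul_assoc mat_mult_mat)
  then show ?thesis unfolding normalizable_def by blast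
qed

lemma normalizable_of_normal_form: "normal_form g \<Longrightarrow> normalizable g"
  unfolding normalizable_def by (rule exI[of _ 1], rule exI[of _ g]) simp

lemma normal_form_flip:
  fixes g :: "'a::idom laurent ^ 2 ^ 2"
  assumes "normal_form g"
  shows "normalizable (flip ** g)"
proof -
  have led: "flip_led (flip ** g) \<Longrightarrow> normalizable (flip ** g)" for g :: "'a laurent ^ 2 ^ 2"
    by (rule normalizable_of_normal_form) (auto simp: normal_form_def)
  have cancel: "normal_form h \<Longrightarrow> normalizable (flip ** (flip ** h))" for h :: "'a laurent ^ 2 ^ 2"
    unfolding flip_square using lt_nonzero
    by (intro normalizable_scalar normalizable_of_normal_form)
  from assms consider "g \<in> {mat 1, rot, rot ** rot}"
    | h where "flip_led h" "g \<in> {rot ** h, rot ** (rot ** h)}" | "flip_led g"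
    unfolding normal_form_def by blast
  then show ?thesis
  proof cases
    case 1
    then have "flip_led (flip ** g)" by (auto intro: flip_led.intros)
    then show ?thesis by (rule led)
  next
    case 2
    then have "flip_led (flip ** g)" by (auto intro: flip_led.intros)
    then show ?thesis by (rule led)
  next
    case 3
    have one: "normal_form (mat 1 :: 'a laurent ^ 2 ^ 2)" by (simp add: normal_form_def)
    from 3 show ?thesis
    proof cases
      case 1
      then show ?thesis using cancel[OF one] by simp
    next
      case 2
      then show ?thesis using cancel[of rot] by (simp add: normal_form_def)
    next
      case 3
      then show ?thesis using cancel[of "rot ** rot"] by (simp add: normal_form_def)
    next
      case (4 h)
      then show ?thesis using cancel[of "rot ** h"] by (auto simp: normal_form_def)
    next
      case (5 h)
      then show ?thesis using cancel[of "rot ** (rot ** h)"] by (auto simp: normal_form_def)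
    qed
  qed
qed

lemma normalizable_rot: "normalizable g \<Longrightarrow> normalizable (rot ** g)"
  unfolding normalizable_def by (metis normal_form_rot scalar_left)

lemma normalizable_flip:
  fixes g :: "'a::idom laurent ^ 2 ^ 2"
  shows "normalizable g \<Longrightarrow> normalizable (flip ** g)"
  by (metis normal_form_flip normalizable_def normalizable_scalar scalar_left)

lemma normalizable_burau: "normalizable (reduced_mat (burau_word w :: 'a::idom laurent_mat3))"
proof (induction w)
  case Nil
  then show ?case
    by (simp add: reduced_one normalizable_of_normal_form normal_form_def)
next
  case (Cons a w)
  obtain c M where "c \<noteq> 0" "reduced_mat (burau_letter a :: 'a laurent_mat3) = mat c ** M"
    "M \<in> {rot ** (rot ** flip), flip ** (rot ** rot), flip ** rot, rot ** flip}"
    using reduced_letter .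
  then show ?case
    using Cons by (auto simp: reduced_mult[OF burau_letter_row_sum] normalizable_rot normalizable_flip
        normalizable_scalar simp flip: matrix_mul_assoc)
qed

lemma lead_rot: "lead (rot :: 'a::comm_ring_1 laurent ^ 2 ^ 2) 0 rot"
  and lead_flip: "lead (flip :: 'a laurent ^ 2 ^ 2) 1 (vector [vector [0, 0], vector [1, 0]])"
  by (auto simp: lead_def rot_def flip_def forall_2 deg_le_def lookup_lt lookup_one_laurent)

text \<open>Multiplication by \<open>flip\<close> raises the degree of the first row and pushes it into the second, so the
  leading matrix of a word starting with \<open>flip\<close> has column space spanned by \<open>(0,1)\<close>. The powers \<open>rot\<close> and
  \<open>rot\<^sup>2\<close> move this line off the kernel of the leading matrix of \<open>flip\<close>, so nothing cancels when the word
  gets longer.\<close>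
lemma lead_flip_led:
  fixes g :: "'a::idom laurent ^ 2 ^ 2"
  assumes "flip_led g"
  shows "\<exists>n r. r \<noteq> 0 \<and> lead g n (vector [0, r])"
  using assms
proof induction
  have ex: "\<exists>n r. r \<noteq> 0 \<and> lead g n (vector [0, r])"
    if "lead g n L" "L $ 1 = 0" "L $ 2 \<noteq> 0" for g :: "'a laurent ^ 2 ^ 2" and n L
  proof -
    have "L = vector [0, L $ 2]" using that(2) by (simp add: vec_eq_iff forall_2)
    with that show ?thesis by metis
  qed
  note fr = lead_mult[OF lead_flip lead_rot]
  note frr = lead_mult[OF lead_flip lead_mult[OF lead_rot lead_rot]]
  {
    case 1
    show ?case by (rule ex[OF lead_flip]) (simp_all add: vec_eq_iff forall_2)
  next
    case 2
    show ?case
      by (rule ex[OF fr]) (simp_all add: rot_def vec_eq_iff forall_2 matrix_matrix_mult_def sum_2)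
  next
    case 3
    show ?case
      by (rule ex[OF frr]) (simp_all add: rot_def vec_eq_iff forall_2 matrix_matrix_mult_def sum_2)
  next
    case (4 g)
    then obtain n r where r: "r \<noteq> 0" "lead g n (vector [0, r])" by blast
    show ?case
      unfolding matrix_mul_assoc
      by (rule ex[OF lead_mult[OF fr r(2)]])
        (use r(1) in \<open>simp_all add: rot_def vec_eq_iff forall_2 matrix_matrix_mult_def sum_2\<close>)
  next
    case (5 g)
    then obtain n r where r: "r \<noteq> 0" "lead g n (vector [0, r])" by blast
    show ?case
      unfolding matrix_mul_assoc
      by (rule ex[OF lead_mult[OF frr[unfolded matrix_mul_assoc] r(2)]])
        (use r(1) in \<open>simp_all add: rot_def vec_eq_iff forall_2 matrix_matrix_mult_def sum_2\<close>)
  }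
qed

text \<open>For a matrix of rank one, the last three alternatives say that its column space is spanned by
  \<open>(0,1)\<close>, \<open>(1,0)\<close> or \<open>(1,-1)\<close>: the three lines along which the image of the braid group leaves the standard
  vertex of the tree.\<close>
definition admissible :: "'a::comm_ring_1 ^ 2 ^ 2 \<Rightarrow> bool" where
  "admissible L \<longleftrightarrow> L \<noteq> 0 \<and> (det L \<noteq> 0 \<or> L $ 1 = 0 \<or> L $ 2 = 0 \<or> L $ 1 + L $ 2 = 0)"

lemma admissible_of_det: "det L \<noteq> 0 \<Longrightarrow> admissible L"
  by (auto simp: admissible_def det_2)

lemma lead_normal_form:
  fixes g :: "'a::idom laurent ^ 2 ^ 2"
  assumes "normal_form g"
  shows "\<exists>n L. lead g n L \<and> admissible L"
proof -
  have one: "lead (mat 1 :: 'a laurent ^ 2 ^ 2) 0 (mat 1)"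
    by (rule lead_mat) (auto simp: deg_le_def lookup_one_laurent)
  note rr = lead_mult[OF lead_rot lead_rot]
  from assms consider "g = mat 1" | "g = rot" | "g = rot ** rot"
    | h where "flip_led h" "g \<in> {h, rot ** h, rot ** (rot ** h)}"
    unfolding normal_form_def by blast
  then show ?thesis
  proof cases
    case 1
    have "admissible (mat 1 :: 'a ^ 2 ^ 2)"
      by (rule admissible_of_det) (simp add: det_2 mat_def)
    with one 1 show ?thesis by blast
  next
    case 2
    have "admissible (rot :: 'a ^ 2 ^ 2)"
      by (rule admissible_of_det) (simp add: det_2 rot_def)
    with lead_rot 2 show ?thesis by blast
  next
    case 3
    have "admissible (rot ** rot :: 'a ^ 2 ^ 2)"
      by (rule admissible_of_det) (simp add: det_2 rot_def matrix_matrix_mult_def sum_2)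
    with rr 3 show ?thesis by blast
  next
    case (4 h)
    obtain n r where r: "r \<noteq> 0" "lead h n (vector [0, r])" using lead_flip_led[OF 4(1)] by blast
    note l = r(2) lead_mult[OF lead_rot r(2)] lead_mult[OF lead_rot lead_mult[OF lead_rot r(2)]]
    have "admissible (vector [0, r] :: 'a ^ 2 ^ 2)" "admissible (rot ** vector [0, r] :: 'a ^ 2 ^ 2)"
      "admissible (rot ** (rot ** vector [0, r]) :: 'a ^ 2 ^ 2)"
      using r(1) by (simp_all add: admissible_def vec_eq_iff forall_2 rot_def
          matrix_matrix_mult_def sum_2)
    with l 4(2) show ?thesis by blast
  qed
qed

lemma lead_burau_admissible:
  fixes c :: "'a::idom laurent"
  assumes "c \<noteq> 0"
  shows "\<exists>n L. lead (mat c ** reduced_mat (burau_word w)) n L \<and> admissible L"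
proof -
  have "normalizable (mat c ** reduced_mat (burau_word w))"
    by (rule normalizable_scalar[OF normalizable_burau assms])
  then obtain b h where b: "b \<noteq> 0" "normal_form h" "mat c ** reduced_mat (burau_word w) = mat b ** h"
    unfolding normalizable_def by blast
  obtain m L where L: "lead h m L" "admissible L" using lead_normal_form[OF b(2)] by blast
  obtain k where k: "deg_le b k" "Poly_Mapping.lookup b k \<noteq> 0" using exists_degree[OF b(1)] .
  have "lead (mat b ** h) (k + m) (mat (Poly_Mapping.lookup b k) ** L)"
    by (rule lead_mult[OF lead_mat[OF k(1) refl] L(1)])
  moreover have "admissible (mat (Poly_Mapping.lookup b k) ** L)"
    using L(2) k(2)
    by (auto simp: admissible_def det_mul det_2 vec_eq_iff forall_2 matrix_matrix_mult_def sum_2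
        mat_def simp flip: distrib_left)
  ultimately show ?thesis unfolding b(3) by blast
qed

section \<open>Unitary reflections\<close>

text \<open>In the basis \<open>diff_basis\<close> the row below has coordinates \<open>(-1, -2)\<close>, the first row of \<open>1 + 2 rot\<close>. The column
  is its dual vector with respect to the Hermitian form \<open>J3\<close>, divided by \<open>1 + t\<close>
  (\<open>reflection_row_J3\<close>).\<close>
definition reflection_row :: "'a::comm_ring_1 laurent ^ 3" where
  "reflection_row = vector [- 1, 1 - 2 * lt, 2 * lt]"

definition reflection_col :: "'a::comm_ring_1 laurent ^ 3" where
  "reflection_col = vector [- 1, - lt_inv, 2 * lt_inv * lt_inv]"

definition reflection :: "'a::comm_ring_1 laurent \<Rightarrow> 'a laurent_mat3" where
  "reflection f = (\<chi> i j. (if i = j then 1 else 0) + f * (reflection_col $ i * reflection_row $ j))"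

text \<open>The condition under which \<open>1 + f \<cdot> col \<cdot> row\<close> lies in the target group. By \<open>reflection_mult\<close> the equation
  says that the reflections with factors \<open>f\<close> and \<open>t \<cdot> bar f\<close> are mutually inverse; vanishing at \<open>t = 1\<close>
  makes the reflection specialize to the identity there.\<close>
definition unitary_factor :: "'a::comm_ring_1 laurent \<Rightarrow> bool" where
  "unitary_factor f \<longleftrightarrow> f + lt * laurent_bar f + 3 * (1 + lt) * f * laurent_bar f = 0
     \<and> laurent_at_1 f = 0"

lemma reflection_row_col:
  "(\<Sum>k\<in>UNIV. reflection_row $ k * reflection_col $ k) = (3 * (1 + lt_inv) :: 'a::comm_ring_1 laurent)"
  by (simp add: sum_3 reflection_row_def reflection_col_def algebra_simps)

definition rank_one :: "'a::comm_ring_1 ^ 'n \<Rightarrow> 'a ^ 'm \<Rightarrow> 'a ^ 'm ^ 'n" where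
  "rank_one x y = (\<chi> i j. x $ i * y $ j)"

lemma rank_one_mult: "rank_one x y ** A = rank_one x (y v* A)"
  by (simp add: rank_one_def vec_eq_iff matrix_matrix_mult_def vector_matrix_mult_def
      sum_distrib_left mult_ac)

lemma mult_rank_one: "A ** rank_one x y = rank_one (A *v x) y"
  by (simp add: rank_one_def vec_eq_iff matrix_matrix_mult_def matrix_vector_mult_def
      sum_distrib_left mult_ac)

lemma reflection_eq: "reflection f = mat 1 + rank_one (f *s reflection_col) reflection_row"
  by (simp add: reflection_def rank_one_def vec_eq_iff mat_def mult.assoc)

lemma vector_mult_rank_one: "x v* rank_one y z = (\<Sum>k\<in>UNIV. x $ k * y $ k) *s z"
  by (simp add: rank_one_def vec_eq_iff vector_matrix_mult_def sum_distrib_left mult_ac)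

lemma matrix_add_mult: "(A + B) ** C = A ** C + B ** (C :: 'a::comm_ring_1 ^ 'n ^ 'm)"
  by (simp add: vec_eq_iff matrix_matrix_mult_def distrib_right sum.distrib)

lemma reflection_col_scaled: "(\<Sum>k\<in>UNIV. reflection_row $ k * (f *s reflection_col) $ k) = 3 * (1 + lt_inv) * f"
proof -
  have "(\<Sum>k\<in>UNIV. reflection_row $ k * (f *s reflection_col) $ k)
      = (\<Sum>k\<in>UNIV. reflection_row $ k * reflection_col $ k) * f"
    unfolding sum_distrib_right by (rule sum.cong) (simp_all add: mult_ac)
  then show ?thesis by (simp only: reflection_row_col)
qed

lemma reflection_mult: "reflection f ** reflection g = reflection (f + g + 3 * (1 + lt_inv) * f * g)"
proof -
  have "reflection f ** reflection g = mat 1 + rank_one (g *s reflection_col) reflection_row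
      + (rank_one (f *s reflection_col) reflection_row
        + rank_one (f *s reflection_col) ((3 * (1 + lt_inv) * g) *s reflection_row))"
    unfolding reflection_eq
    by (simp only: matrix_add_ldistrib matrix_add_mult matrix_mul_lid matrix_mul_rid
        rank_one_mult[of _ _ "rank_one _ _"] vector_mult_rank_one reflection_col_scaled)
      (simp only: add_ac)
  then show ?thesis
    unfolding reflection_eq by (simp add: rank_one_def vec_eq_iff algebra_simps)
qed

lemma reflection_zero: "reflection 0 = mat 1"
  by (simp add: reflection_def mat_def vec_eq_iff)

lemma reflection_row_sum: "reflection f *v 1 = 1"
  by (simp add: row_sum_1 reflection_def reflection_row_def forall_3 algebra_simps)

lemma reflection_fixes_v: "burau_v v* reflection f = burau_v"
  by (simp add: burau_v_def reflection_def reflection_col_def vector_matrix_mult_def vec_eq_iff sum_3 forall_3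
      power2_eq_square power3_eq_cube algebra_simps)

lemma laurent_bar_numeral: "laurent_bar (numeral k) = (numeral k :: 'a::comm_ring_1 laurent)"
  using laurent_bar_single[of 0 "numeral k :: 'a"] by simp

definition bar_vector :: "'a::comm_ring_1 laurent ^ 'n \<Rightarrow> 'a laurent ^ 'n" where
  "bar_vector x = (\<chi> i. laurent_bar (x $ i))"

lemma vector_matrix_mult_add: "x v* (A + B) = x v* A + x v* (B :: 'a::comm_ring_1 ^ 'n ^ 'm)"
  by (simp add: vec_eq_iff vector_matrix_mult_def distrib_left sum.distrib)

lemma vector_matrix_mult_scale: "(c *s x) v* A = c *s (x v* (A :: 'a::comm_ring_1 ^ 'n ^ 'm))"
  by (simp add: vec_eq_iff vector_matrix_mult_def sum_distrib_left mult_ac)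

lemma bar_reflection: "map_matrix laurent_bar (reflection f)
    = mat 1 + rank_one (laurent_bar f *s bar_vector reflection_col) (bar_vector reflection_row)"
  by (simp add: reflection_def rank_one_def bar_vector_def vec_eq_iff mat_def laurent_bar_add laurent_bar_mult mult.assoc)

lemma reflection_row_J3: "bar_vector reflection_row v* J3 = (1 + lt) *s reflection_col"
  and J3_reflection_row: "J3 *v reflection_row = (1 + lt_inv) *s bar_vector reflection_col"
  by (simp_all add: reflection_row_def reflection_col_def bar_vector_def J3_def vec_eq_iff forall_3 sum_3 vector_matrix_mult_def
      matrix_vector_mult_def laurent_bar_mult laurent_bar_add laurent_bar_diff laurent_bar_uminus
      laurent_bar_numeral) (simp_all add: algebra_simps)

lemma transpose_reflection: "transpose (reflection f) = mat 1 + rank_one reflection_row (f *s reflection_col)"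
  by (simp add: reflection_def rank_one_def transpose_def vec_eq_iff mat_def mult_ac)

text \<open>Since \<open>J3\<close> turns the row into a multiple of the column and vice versa, all four terms of the expanded
  product are multiples of one matrix of rank one, and only a scalar condition on \<open>f\<close> remains.\<close>
lemma reflection_unitary_defect:
  fixes f :: "'a::comm_ring_1 laurent"
  shows "map_matrix laurent_bar (reflection f) ** J3 ** transpose (reflection f) = J3
    + rank_one ((1 + lt_inv) *s bar_vector reflection_col)
        ((f + lt * laurent_bar f + 3 * (1 + lt) * f * laurent_bar f) *s reflection_col)"
    (is "_ = J3 + rank_one _ (?d *s _)")
proof -
  let ?c = "bar_vector reflection_col :: 'a laurent ^ 3"
  have cT: "reflection_col v* transpose (reflection f) = (1 + 3 * (1 + lt_inv) * f) *s reflection_col"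
  proof -
    have "(\<Sum>k\<in>UNIV. reflection_col $ k * reflection_row $ k) = (3 * (1 + lt_inv) :: 'a laurent)"
      using reflection_row_col by (simp add: mult.commute)
    then have "reflection_col v* rank_one reflection_row (f *s reflection_col)
        = (3 * (1 + lt_inv) * f) *s reflection_col"
      by (simp add: vector_mult_rank_one vec_eq_iff mult.assoc)
    then show ?thesis
      unfolding transpose_reflection
      by (simp only: vector_matrix_mult_add vector_matrix_mat_1) (simp add: vec_eq_iff distrib_right)
  qed
  have left: "map_matrix laurent_bar (reflection f) ** J3
      = J3 + rank_one (laurent_bar f *s ?c) ((1 + lt) *s reflection_col)"
    unfolding bar_reflection
    by (simp only: matrix_add_mult rank_one_mult reflection_row_J3 matrix_mul_lid)
  have right: "J3 ** transpose (reflection f) = J3 + rank_one ((1 + lt_inv) *s ?c) (f *s reflection_col)"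
    unfolding transpose_reflection
    by (simp only: matrix_add_ldistrib mult_rank_one J3_reflection_row matrix_mul_rid)
  have "map_matrix laurent_bar (reflection f) ** J3 ** transpose (reflection f)
      = J3 + rank_one ((1 + lt_inv) *s ?c) (f *s reflection_col)
        + rank_one (laurent_bar f *s ?c) ((1 + lt) *s ((1 + 3 * (1 + lt_inv) * f) *s reflection_col))"
    by (simp only: left matrix_add_mult right rank_one_mult vector_matrix_mult_scale cT)
  also have "\<dots> = J3 + rank_one ((1 + lt_inv) *s ?c) (?d *s reflection_col)"
    by (simp add: vec_eq_iff rank_one_def; simp add: algebra_simps)
  finally show ?thesis .
qed

lemma reflection_inverse:
  assumes "unitary_factor f"
  shows "reflection f ** reflection (lt * laurent_bar f) = mat 1"
    "reflection (lt * laurent_bar f) ** reflection f = mat 1"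
proof -
  have "f + lt * laurent_bar f + 3 * (1 + lt_inv) * f * (lt * laurent_bar f)
      = f + lt * laurent_bar f + 3 * (1 + lt) * f * laurent_bar f"
    by (simp add: algebra_simps)
  also have "\<dots> = 0" using assms by (simp add: unitary_factor_def)
  finally have z: "f + lt * laurent_bar f + 3 * (1 + lt_inv) * f * (lt * laurent_bar f) = 0" .
  show "reflection f ** reflection (lt * laurent_bar f) = mat 1"
    by (simp only: reflection_mult z reflection_zero)
  have "lt * laurent_bar f + f + 3 * (1 + lt_inv) * (lt * laurent_bar f) * f = 0"
    using z by (simp add: ac_simps)
  then show "reflection (lt * laurent_bar f) ** reflection f = mat 1"
    by (simp add: reflection_mult reflection_zero)
qed

lemma reflection_Gamma3:
  assumes "unitary_factor f"
  shows "reflection f \<in> carrier (Gamma3 :: 'a::comm_ring_1 laurent_mat3 monoid)"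
proof -
  have "map_matrix laurent_at_1 (reflection f) = mat 1"
    using assms by (simp add: unitary_factor_def reflection_def mat_def vec_eq_iff laurent_at_1_add laurent_at_1_mult)
  then have "map_matrix laurent_at_1 (reflection f) \<in> perm_matrices"
    unfolding perm_matrices_def using mat_1_perm permutes_id by (auto intro!: exI[of _ id])
  moreover have "invertible (reflection f)"
    unfolding invertible_def using reflection_inverse[OF assms] by blast
  moreover have "map_matrix laurent_bar (reflection f) ** J3 ** transpose (reflection f) = J3"
    unfolding reflection_unitary_defect using assms by (simp add: unitary_factor_def rank_one_def vec_eq_iff)
  ultimately show ?thesis
    by (simp add: Gamma3_def reflection_row_sum reflection_fixes_v)
qed

lemma reduced_reflection: "reduced_mat (reflection f) = vector
   [vector [1 + f * (1 - lt_inv), 2 * (f * (1 - lt_inv))],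
    vector [f * (1 + 2 * lt_inv), 1 + 2 * (f * (1 + 2 * lt_inv))]]"
proof -
  have "reduced_mat (reflection f) = mat 1
      + rank_one (diff_basis *v (f *s reflection_col)) (reflection_row v* diff_basis_section)"
    unfolding reduced_mat_def reflection_eq
    by (simp only: matrix_add_ldistrib matrix_add_mult matrix_mul_rid diff_basis_mult_section
        mult_rank_one rank_one_mult)
  also have "diff_basis *v (f *s reflection_col) = vector [f * (lt_inv - 1), - f * (1 + 2 * lt_inv)]"
    by (simp add: diff_basis_def reflection_col_def matrix_vector_mult_def sum_3 vec_eq_iff forall_2)
      (simp add: algebra_simps)
  also have "reflection_row v* diff_basis_section = vector [- 1, - 2]"
    by (simp add: diff_basis_section_def reflection_row_def vector_matrix_mult_def sum_3 vec_eq_iff forall_2)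
      (simp add: algebra_simps)
  finally show ?thesis
    by (simp add: rank_one_def mat_def vec_eq_iff forall_2) (simp add: algebra_simps)
qed

lemma lookup_two_mult: "Poly_Mapping.lookup (2 * f) k = 2 * Poly_Mapping.lookup f k"
  for f :: "'a::comm_ring_1 laurent"
  by (simp only: mult_2 lookup_add)

lemma deg_le_two_mult: "deg_le f n \<Longrightarrow> deg_le (2 * f) n"
  by (simp add: deg_le_def lookup_two_mult)

text \<open>The leading column of the reduced reflection is \<open>(1,1)\<close> times the top coefficient of \<open>f\<close>; the
  identity summand does not reach degree \<open>d \<ge> 1\<close>.\<close>
lemma lead_reduced_reflection:
  fixes f :: "'a::comm_ring_1 laurent"
  assumes "deg_le f d" "d \<ge> 1"
  shows "lead (reduced_mat (reflection f)) d
    (vector [vector [Poly_Mapping.lookup f d, 2 * Poly_Mapping.lookup f d],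
      vector [Poly_Mapping.lookup f d, 2 * Poly_Mapping.lookup f d]])"
proof -
  have small: "deg_le (1 - lt_inv :: 'a laurent) 0" "deg_le (1 + 2 * lt_inv :: 'a laurent) 0"
      "Poly_Mapping.lookup (1 - lt_inv) 0 = (1 :: 'a)" "Poly_Mapping.lookup (1 + 2 * lt_inv) 0 = (1 :: 'a)"
    by (auto simp: deg_le_def lookup_add lookup_minus lookup_two_mult lookup_lt_inv lookup_one_laurent)
  have "deg_le (f * (1 - lt_inv)) d" "deg_le (f * (1 + 2 * lt_inv)) d"
    "Poly_Mapping.lookup (f * (1 - lt_inv)) d = Poly_Mapping.lookup f d"
    "Poly_Mapping.lookup (f * (1 + 2 * lt_inv)) d = Poly_Mapping.lookup f d"
    using deg_le_mult[OF assms(1) small(1)] deg_le_mult[OF assms(1) small(2)]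
      lookup_mult_top[OF assms(1) small(1)] lookup_mult_top[OF assms(1) small(2)] small
    by simp_all
  moreover have "deg_le (1 :: 'a laurent) d" "Poly_Mapping.lookup (1 :: 'a laurent) d = 0"
    using assms(2) by (auto simp: deg_le_def lookup_one_laurent)
  ultimately show ?thesis
    unfolding reduced_reflection lead_def
    by (simp add: forall_2 lookup_add deg_le_add lookup_two_mult deg_le_two_mult)
qed

text \<open>In odd characteristic the line spanned by \<open>(1,1)\<close> differs from the three lines that words in the braid
  generators can start along.\<close>
lemma reflection_not_in_image:
  fixes f :: "'a::idom laurent"
  assumes f: "deg_le f d" "Poly_Mapping.lookup f d \<noteq> 0" "d \<ge> 1" and two: "(2 :: 'a) \<noteq> 0" and c: "c \<noteq> 0"
  shows "reduced_mat (reflection f) \<noteq> mat c ** reduced_mat (burau_word w)"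
proof
  assume eq: "reduced_mat (reflection f) = mat c ** reduced_mat (burau_word w)"
  obtain n L where L: "lead (reduced_mat (reflection f)) n L" "admissible L"
    using lead_burau_admissible[OF c] unfolding eq by blast
  define k where "k = Poly_Mapping.lookup f d"
  let ?M = "vector [vector [k, 2 * k], vector [k, 2 * k]] :: 'a ^ 2 ^ 2"
  have "lead (reduced_mat (reflection f)) d ?M"
    using lead_reduced_reflection[OF f(1,3)] by (simp add: k_def)
  moreover have "?M \<noteq> 0" using f(2) by (auto simp: k_def vec_eq_iff forall_2)
  ultimately have "L = ?M" using lead_unique L unfolding admissible_def by blast
  moreover have "(4 :: 'a) \<noteq> 0"
  proof -
    have "(4 :: 'a) = 2 * 2" by simp
    with two show ?thesis by (metis mult_eq_0_iff)
  qed
  with two f(2) have "k \<noteq> 0" "2 * k \<noteq> 0" "4 * k \<noteq> 0"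
    by (auto simp: k_def)
  ultimately show False
    using L(2) by (auto simp: admissible_def det_2 vec_eq_iff forall_2)
qed

text \<open>The polynomial \<open>g\<close> is the factor of the reflection for \<open>F m\<close> times the inverse of the one for \<open>F n\<close>.
  Positive degree of \<open>g\<close> is what \<open>reflection_not_in_image\<close> asks for.\<close>
definition separated_factors :: "(nat \<Rightarrow> 'a::comm_ring_1 laurent) \<Rightarrow> bool" where
  "separated_factors F \<longleftrightarrow> (\<forall>n. unitary_factor (F n)) \<and>
    (\<forall>m n. n < m \<longrightarrow> (\<exists>d\<ge>1. let g = F m + lt * laurent_bar (F n) + 3 * (1 + lt) * F m * laurent_bar (F n)
       in deg_le g d \<and> Poly_Mapping.lookup g d \<noteq> 0))"

lemma lt_power: "lt ^ n = Poly_Mapping.single (int n) (1 :: 'a::comm_ring_1)"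
  and lt_inv_power: "lt_inv ^ n = Poly_Mapping.single (- int n) (1 :: 'a::comm_ring_1)"
  by (induction n) (simp_all add: lt_def lt_inv_def mult_single add.commute)

text \<open>In characteristic 3 the row is isotropic, the condition on \<open>f\<close> becomes the linear one
  \<open>t \<cdot> bar f = - f\<close>, and factors simply subtract under quotients.\<close>
lemma separated_factors_char_3:
  assumes "(3 :: 'a::idom) = 0"
  shows "separated_factors (\<lambda>n. lt ^ Suc n - lt_inv ^ n :: 'a laurent)"
proof -
  have three: "(3 :: 'a laurent) = 0"
    using assms single_numeral[of "Num.Bit1 Num.One", where 'a = int and 'b = 'a] by simp
  have bar: "laurent_bar (lt ^ Suc n - lt_inv ^ n) = (lt_inv ^ Suc n - lt ^ n :: 'a laurent)" for n
    unfolding lt_power lt_inv_power by (simp add: laurent_bar_diff laurent_bar_single)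
  have tbar: "lt * laurent_bar (lt ^ Suc n - lt_inv ^ n) = - (lt ^ Suc n - lt_inv ^ n :: 'a laurent)" for n
    unfolding bar by (simp add: algebra_simps)
  have at1: "laurent_at_1 (lt ^ Suc n - lt_inv ^ n :: 'a laurent) = 0" for n
    unfolding lt_power lt_inv_power diff_conv_add_uminus laurent_at_1_add laurent_at_1_uminus
    by (simp add: laurent_at_1_single)
  have sep: "\<exists>d\<ge>1. deg_le (lt ^ Suc m - lt_inv ^ m + - (lt ^ Suc n - lt_inv ^ n) :: 'a laurent) d
      \<and> Poly_Mapping.lookup (lt ^ Suc m - lt_inv ^ m + - (lt ^ Suc n - lt_inv ^ n) :: 'a laurent) d \<noteq> 0"
    if "n < m" for m n
    using that unfolding lt_power lt_inv_power
    by (intro exI[of _ "int (Suc m)"])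
      (auto simp: deg_le_def lookup_add lookup_minus lookup_single when_def)
  show ?thesis
    unfolding separated_factors_def unitary_factor_def tbar Let_def three mult_zero_left add_0_right
    using sep at1 by (auto simp del: power_Suc)
qed

text \<open>The reflection with factor \<open>f\<close> has eigenvalue \<open>1 + 3 (1 + t\<^sup>-\<^sup>1) f\<close> on the row, and this eigenvalue
  determines \<open>f\<close> and is multiplicative. The sequence below is the one with eigenvalues \<open>t ^ (2 n)\<close>; the exponents
  are even so that \<open>1 + t\<close> divides \<open>t ^ (2 n) - 1\<close>. A quotient has eigenvalue \<open>t ^ (2 (m - n))\<close>, so its
  factor has degree \<open>2 (m - n)\<close>.\<close>
lemma separated_factors_char_not_3:
  assumes three: "(3 :: 'a::field) \<noteq> 0"
  shows "\<exists>F :: nat \<Rightarrow> 'a laurent. separated_factors F"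
proof -
  define D :: "'a laurent" where "D = 3 * (1 + lt)"
  define third :: "'a laurent" where "third = Poly_Mapping.single 0 (1 / 3)"
  define F :: "nat \<Rightarrow> 'a laurent" where
    "F n = third * (lt * ((lt - 1) * (\<Sum>i<n. (lt ^ 2) ^ i)))" for n
  have third: "3 * third = 1"
  proof -
    have "3 * third = Poly_Mapping.single 0 3 * Poly_Mapping.single 0 (1 / 3)"
      by (simp add: third_def)
    also have "\<dots> = 1" using three by (simp only: mult_single) simp
    finally show ?thesis .
  qed
  have DF: "D * F n = lt * (lt ^ (2 * n) - 1)" for n
  proof -
    have "D * F n = (3 * third) * (lt * ((lt ^ 2 - 1) * (\<Sum>i<n. (lt ^ 2) ^ i)))"
      by (simp add: D_def F_def algebra_simps power2_eq_square)
    then show ?thesis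
      by (simp add: third power_diff_1_eq[symmetric] power_mult)
  qed
  have barD: "D = lt * laurent_bar D"
    by (simp add: D_def laurent_bar_mult laurent_bar_add laurent_bar_numeral algebra_simps)
  have bar_power: "laurent_bar (lt ^ k) = (lt_inv ^ k :: 'a laurent)" for k
    unfolding lt_power lt_inv_power by (simp add: laurent_bar_single)
  have DbarF: "D * laurent_bar (F n) = lt_inv ^ (2 * n) - 1" for n
  proof -
    have "D * laurent_bar (F n) = lt * laurent_bar (D * F n)"
      by (subst barD) (simp add: laurent_bar_mult mult.assoc)
    then show ?thesis by (simp add: DF laurent_bar_mult laurent_bar_diff bar_power)
  qed
  define G where "G m n = F m + lt * laurent_bar (F n) + 3 * (1 + lt) * F m * laurent_bar (F n)" for m n
  have DG: "D * G m n = lt * (lt ^ (2 * m) * lt_inv ^ (2 * n) - 1)" for m n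
  proof -
    have "D * G m n = D * F m + lt * (D * laurent_bar (F n)) + (D * F m) * (D * laurent_bar (F n))"
      by (simp add: G_def D_def algebra_simps)
    then show ?thesis unfolding DF DbarF by (simp add: algebra_simps)
  qed
  have topD: "deg_le D 1" "Poly_Mapping.lookup D 1 = 3"
  proof -
    have "D = Poly_Mapping.single 0 3 + Poly_Mapping.single 1 3"
      by (simp add: D_def lt_def algebra_simps mult_single flip: single_numeral)
    then show "deg_le D 1" "Poly_Mapping.lookup D 1 = 3"
      by (auto simp: deg_le_def lookup_add lookup_single when_def lookup_numeral)
  qed
  have D0: "D \<noteq> 0" using topD(2) three by auto
  have cancel: "lt ^ k * lt_inv ^ k = (1 :: 'a laurent)" for k
    by (simp flip: power_mult_distrib)
  have "G n n = 0" for n using DG[of n n] D0 by (simp add: cancel)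
  moreover have "laurent_at_1 (F n) = 0" for n
    by (simp only: F_def laurent_at_1_mult diff_conv_add_uminus laurent_at_1_add laurent_at_1_uminus)
      (simp add: lt_def laurent_at_1_single)
  moreover have "\<exists>d\<ge>1. deg_le (G m n) d \<and> Poly_Mapping.lookup (G m n) d \<noteq> 0" if "n < m" for m n
  proof -
    define e where "e = 2 * int m - 2 * int n"
    have e: "e > 0" using that by (simp add: e_def)
    have DG': "D * G m n = Poly_Mapping.single (1 + e) 1 - Poly_Mapping.single 1 1"
      unfolding DG lt_power lt_inv_power
      by (simp add: lt_def mult_single right_diff_distrib e_def)
    then have coeff: "Poly_Mapping.lookup (D * G m n) k = (if k = 1 + e then 1 else if k = 1 then - 1 else 0)" for k
      using e by (auto simp: lookup_minus lookup_single when_def)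
    have "G m n \<noteq> 0" using coeff[of "1 + e"] by auto
    then obtain d where d: "deg_le (G m n) d" "Poly_Mapping.lookup (G m n) d \<noteq> 0"
      using exists_degree by blast
    have "Poly_Mapping.lookup (D * G m n) (1 + d) \<noteq> 0"
      using lookup_mult_top[OF topD(1) d(1)] d(2) three topD(2) by simp
    moreover have "\<not> 1 + e > 1 + d"
      using deg_le_mult[OF topD(1) d(1)] coeff[of "1 + e"] unfolding deg_le_def by auto
    ultimately have "d \<ge> 1" using e coeff[of "1 + d"] by (auto split: if_splits)
    with d show ?thesis by blast
  qed
  ultimately have "separated_factors F"
    by (simp add: separated_factors_def unitary_factor_def G_def Let_def)
  then show ?thesis by (rule exI[of _ F])
qed

section \<open>The unitary group of rank two\<close>

text \<open>The Gram matrix of \<open>J3\<close> on the basis \<open>diff_basis\<close> (\<open>herm_eq\<close>).\<close>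
definition herm :: "'a::comm_ring_1 laurent ^ 2 ^ 2" where
  "herm = vector [vector [2 + lt + lt_inv, - 1 - lt], vector [- 1 - lt_inv, 2 + lt + lt_inv]]"

definition unitary :: "'a::comm_ring_1 laurent ^ 2 ^ 2 \<Rightarrow> bool" where
  "unitary g \<longleftrightarrow> map_matrix laurent_bar g ** herm ** transpose g = herm"

lemma map_bar_mult:
  fixes A :: "'a::comm_ring_1 laurent ^ 'n ^ 'm" and B :: "'a laurent ^ 'k ^ 'n"
  shows "map_matrix laurent_bar (A ** B) = map_matrix laurent_bar A ** map_matrix laurent_bar B"
  by (simp add: vec_eq_iff matrix_matrix_mult_def laurent_bar_sum laurent_bar_mult)

lemma transpose_matrix_mult:
  fixes A :: "'a::comm_ring_1 ^ 'n ^ 'm" and B :: "'a ^ 'k ^ 'n"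
  shows "transpose (A ** B) = transpose B ** transpose A"
  by (simp add: vec_eq_iff matrix_matrix_mult_def transpose_def mult.commute)

lemma unitary_mult: "unitary g \<Longrightarrow> unitary h \<Longrightarrow> unitary (g ** h)"
  unfolding unitary_def map_bar_mult transpose_matrix_mult
  by (metis matrix_mul_assoc)

lemma herm_eq: "herm = map_matrix laurent_bar diff_basis ** J3 ** transpose diff_basis"
  by (simp add: herm_def diff_basis_def J3_def vec_eq_iff forall_2 matrix_matrix_mult_def sum_3
      transpose_def laurent_bar_uminus)
    (simp add: algebra_simps)

lemma unitary_reduced:
  assumes "A \<in> carrier (Gamma3 :: 'a::comm_ring_1 laurent_mat3 monoid)"
  shows "unitary (reduced_mat A)"
proof -
  have A: "A *v 1 = 1" "map_matrix laurent_bar A ** J3 ** transpose A = J3"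
    using assms by (simp_all add: Gamma3_def)
  have "map_matrix laurent_bar (reduced_mat A) ** herm ** transpose (reduced_mat A)
      = map_matrix laurent_bar (reduced_mat A ** diff_basis) ** J3 ** transpose (reduced_mat A ** diff_basis)"
    unfolding herm_eq map_bar_mult transpose_matrix_mult by (simp only: matrix_mul_assoc)
  also have "\<dots> = map_matrix laurent_bar diff_basis ** (map_matrix laurent_bar A ** J3 ** transpose A)
      ** transpose diff_basis"
    unfolding reduced_mult_diff_basis[OF A(1)] map_bar_mult transpose_matrix_mult
    by (simp only: matrix_mul_assoc)
  finally show ?thesis by (simp add: unitary_def A(2) herm_eq)
qed

definition adjugate2 :: "'a::comm_ring_1 ^ 2 ^ 2 \<Rightarrow> 'a ^ 2 ^ 2" where
  "adjugate2 A = vector [vector [A $ 2 $ 2, - A $ 1 $ 2], vector [- A $ 2 $ 1, A $ 1 $ 1]]"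

lemma adjugate2_mult: "A ** adjugate2 A = mat (det A)"
  by (simp add: adjugate2_def vec_eq_iff forall_2 matrix_matrix_mult_def sum_2 mat_def det_2 mult.commute)

lemma det_herm: "det herm = (lt * lt + 3 * lt + 4 + 3 * lt_inv + lt_inv * lt_inv :: 'a::comm_ring_1 laurent)"
  by (simp add: det_2 herm_def algebra_simps)

lemma deg_det_herm: "deg_le (det herm :: 'a::comm_ring_1 laurent) 2"
    "Poly_Mapping.lookup (det herm :: 'a laurent) 2 = 1"
proof -
  have "det herm = Poly_Mapping.single 2 1 + Poly_Mapping.single 1 3 + Poly_Mapping.single 0 4
      + Poly_Mapping.single (-1) 3 + Poly_Mapping.single (-2) (1 :: 'a)"
  proof -
    have "3 * lt = Poly_Mapping.single 0 3 * Poly_Mapping.single 1 (1 :: 'a)"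
      "3 * lt_inv = Poly_Mapping.single 0 3 * Poly_Mapping.single (-1) (1 :: 'a)"
      by (simp_all add: lt_def lt_inv_def)
    then show ?thesis unfolding det_herm by (simp only: mult_single) (simp add: lt_def lt_inv_def mult_single)
  qed
  then show "deg_le (det herm :: 'a laurent) 2" "Poly_Mapping.lookup (det herm :: 'a laurent) 2 = 1"
    by (auto simp: deg_le_def lookup_add lookup_single when_def lookup_numeral)
qed

lemma lead_herm: "lead (herm :: 'a::comm_ring_1 laurent ^ 2 ^ 2) 1 (vector [vector [1, - 1], vector [0, 1]])"
  by (auto simp: lead_def herm_def forall_2 deg_le_def lookup_add lookup_minus lookup_lt lookup_lt_inv
      lookup_one_laurent lookup_numeral)

lemma lead_transpose: "lead A n L \<Longrightarrow> lead (transpose A) n (transpose L)"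
  by (simp add: lead_def transpose_def)

lemma lead_adjugate2: "lead A n L \<Longrightarrow> lead (adjugate2 A) n (adjugate2 L)"
  by (simp add: lead_def adjugate2_def forall_2 deg_le_uminus)

lemma lead_det:
  fixes A :: "'a::comm_ring_1 laurent ^ 2 ^ 2"
  assumes "lead A n L"
  shows "deg_le (det A) (2 * n)" "Poly_Mapping.lookup (det A) (2 * n) = det L"
proof -
  have d: "deg_le (A $ i $ j) n" "Poly_Mapping.lookup (A $ i $ j) n = L $ i $ j" for i j
    using assms by (simp_all add: lead_def)
  have "deg_le (- (A $ 1 $ 2 * A $ 2 $ 1)) (n + n)" "deg_le (A $ 1 $ 1 * A $ 2 $ 2) (n + n)"
    using deg_le_mult d deg_le_uminus by blast+
  then show "deg_le (det A) (2 * n)"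
    unfolding det_2 diff_conv_add_uminus mult_2 by (intro deg_le_add)
  show "Poly_Mapping.lookup (det A) (2 * n) = det L"
    unfolding det_2 mult_2 lookup_minus lookup_mult_top[OF d(1) d(1)] by (simp add: d(2))
qed

lemma deg_le_bar_det:
  fixes g :: "'a::idom laurent ^ 2 ^ 2"
  assumes "unitary g" "deg_le (det g) n" "Poly_Mapping.lookup (det g) n \<noteq> 0"
  shows "laurent_bar (det g) * det g = 1" "deg_le (laurent_bar (det g)) (- n)"
proof -
  let ?e = "laurent_bar (det g)"
  have bar_det: "det (map_matrix laurent_bar g) = ?e"
    by (simp add: det_2 laurent_bar_diff laurent_bar_mult)
  have "?e * det herm * det g = det herm"
    using arg_cong[OF assms(1)[unfolded unitary_def], of det] by (simp add: det_mul bar_det)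
  then have "det herm * (?e * det g - 1) = 0" by (simp add: algebra_simps)
  moreover have "det herm \<noteq> (0 :: 'a laurent)"
    using deg_det_herm(2)[where 'a = 'a] by auto
  ultimately show e: "?e * det g = 1" by simp
  then have "?e \<noteq> 0" by auto
  then obtain q where q: "deg_le ?e q" "Poly_Mapping.lookup ?e q \<noteq> 0" using exists_degree by blast
  then have "Poly_Mapping.lookup (1 :: 'a laurent) (q + n) \<noteq> 0"
    using lookup_mult_top[OF q(1) assms(2)] assms(3) unfolding e by simp
  then have "q = - n" by (simp add: lookup_one_laurent split: if_splits)
  with q show "deg_le ?e (- n)" by simp
qed

lemma lead_deg_le: "lead A n L \<Longrightarrow> deg_le (A $ i $ j) n"
  by (simp add: lead_def)

text \<open>Unitarity expresses the conjugate of \<open>g\<close> through the inverse of \<open>g\<close>. If the leading matrix at degree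
  \<open>m\<close> is invertible, then \<open>det g\<close> has degree exactly \<open>2 m\<close> and the inverse of \<open>g\<close> has degree at most \<open>-m\<close>;
  hence so does the conjugate, which means that no exponent below \<open>m\<close> occurs in \<open>g\<close>. In terms of
  the tree: a unitary element that fixes the standard vertex at \<open>t = \<infinity>\<close> also fixes the one at
  \<open>t = 0\<close>, so up to a power of \<open>t\<close> it is constant.\<close>
lemma unitary_lead_invertible:
  fixes g :: "'a::idom laurent ^ 2 ^ 2"
  assumes g: "unitary g" and L: "lead g m L" "det L \<noteq> 0"
  shows "g $ i $ j = Poly_Mapping.single m (L $ i $ j)"
proof -
  let ?b = "map_matrix laurent_bar g" and ?e = "laurent_bar (det g)"
  have det: "deg_le (det g) (2 * m)" "Poly_Mapping.lookup (det g) (2 * m) \<noteq> 0"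
    using lead_det[OF L(1)] L(2) by auto
  note e = deg_le_bar_det[OF g det]
  have tr: "transpose g ** transpose (adjugate2 g) = mat (det g)"
  proof -
    have "adjugate2 g ** g = mat (det g)"
      by (simp add: adjugate2_def vec_eq_iff forall_2 matrix_matrix_mult_def sum_2 mat_def det_2 mult.commute)
    then show ?thesis by (metis transpose_matrix_mult transpose_mat)
  qed
  have "mat ?e ** (herm ** transpose (adjugate2 g) ** adjugate2 herm)
      = mat ?e ** (?b ** herm ** (transpose g ** transpose (adjugate2 g)) ** adjugate2 herm)"
    using g by (simp add: unitary_def matrix_mul_assoc)
  also have "?b ** herm ** (transpose g ** transpose (adjugate2 g)) ** adjugate2 herm
      = mat (det g) ** (?b ** (herm ** adjugate2 herm))"
    unfolding tr by (simp only: scalar_left matrix_mul_assoc[symmetric])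
  also have "mat ?e ** (mat (det g) ** (?b ** (herm ** adjugate2 herm))) = ?b ** mat (det herm)"
    unfolding adjugate2_mult by (simp only: matrix_mul_assoc[of "mat ?e"] mat_mult_mat e(1) matrix_mul_lid)
  also have "\<dots> = mat (det herm) ** ?b"
    by (rule mat_mult_commute[symmetric])
  finally have eq: "mat (det herm) ** ?b = mat ?e ** (herm ** transpose (adjugate2 g) ** adjugate2 herm)" ..
  have entry: "(mat (det herm) ** ?b) $ i $ j = det herm * laurent_bar (g $ i $ j)" for i j
    by (simp add: matrix_matrix_mult_def mat_def if_distrib[of "\<lambda>x. x * _"] cong: if_cong)
  have "lead (mat ?e) (- (2 * m)) (mat (Poly_Mapping.lookup ?e (- (2 * m))))"
    using e(2) by (rule lead_mat) simp
  from lead_mult[OF this lead_mult[OF lead_mult[OF lead_herm lead_transpose[OF lead_adjugate2[OF L(1)]]]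
      lead_adjugate2[OF lead_herm]]]
  have bound: "deg_le (det herm * laurent_bar (g $ i $ j)) (2 - m)" for i j
    unfolding entry[symmetric] eq by (rule deg_le_mono[OF lead_deg_le]) simp
  \<comment> \<open>An entry of degree \<open>q\<close> in the conjugate of \<open>g\<close> gives one of degree \<open>q + 2\<close> after multiplication by
      \<open>det herm\<close>, so \<open>bound\<close> forces \<open>q \<le> - m\<close>.\<close>
  have low: "m \<le> k" if "Poly_Mapping.lookup (g $ i $ j) k \<noteq> 0" for k
  proof -
    let ?f = "laurent_bar (g $ i $ j)"
    have k: "Poly_Mapping.lookup ?f (- k) \<noteq> 0" using that by (simp add: lookup_laurent_bar)
    then have "?f \<noteq> 0" by auto
    then obtain q where q: "deg_le ?f q" "Poly_Mapping.lookup ?f q \<noteq> 0" using exists_degree by blast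
    have "Poly_Mapping.lookup (det herm * ?f) (2 + q) \<noteq> 0"
      using lookup_mult_top[OF deg_det_herm(1) q(1)] deg_det_herm(2)[where 'a = 'a] q(2) by simp
    with bound[of i j] have "\<not> 2 - m < 2 + q" unfolding deg_le_def by blast
    then have "q \<le> - m" by simp
    moreover have "- k \<le> q" using q(1) k unfolding deg_le_def by (meson not_le)
    ultimately show ?thesis by simp
  qed
  have high: "k \<le> m" if "Poly_Mapping.lookup (g $ i $ j) k \<noteq> 0" for k
    using that L(1) unfolding lead_def deg_le_def by (meson not_le)
  show ?thesis
  proof (rule poly_mapping_eqI)
    fix k
    show "Poly_Mapping.lookup (g $ i $ j) k = Poly_Mapping.lookup (Poly_Mapping.single m (L $ i $ j)) k"
      using low[of k] high[of k] L(1) by (cases "k = m") (auto simp: lookup_single lead_def when_def)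
  qed
qed

text \<open>Comparing the coefficients of \<open>t\<close> in the unitarity equation leaves an isometry of the bilinear form
  given by the leading matrix of \<open>herm\<close>.\<close>
lemma unitary_lead_isometry:
  fixes g :: "'a::idom laurent ^ 2 ^ 2"
  assumes g: "unitary g" and L: "lead g m L" "det L \<noteq> 0"
  shows "L ** vector [vector [1, - 1], vector [0, 1]] ** transpose L = vector [vector [1, - 1], vector [0, 1]]"
proof -
  have "lead (map_matrix laurent_bar g) (- m) L"
    by (auto simp: lead_def unitary_lead_invertible[OF assms] laurent_bar_single deg_le_def
        lookup_single when_def)
  from lead_mult[OF lead_mult[OF this lead_herm] lead_transpose[OF L(1)]]
  have "lead herm 1 (L ** vector [vector [1, - 1], vector [0, 1]] ** transpose L)"
    using g by (simp add: unitary_def)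
  with lead_herm[where 'a = 'a] show ?thesis
    by (auto simp: lead_def vec_eq_iff)
qed

section \<open>Characteristic two\<close>

lemma rot_square: "rot ** rot = (vector [vector [0, 1], vector [- 1, - 1]] :: 'a::comm_ring_1 ^ 2 ^ 2)"
  by (simp add: rot_def vec_eq_iff forall_2 matrix_matrix_mult_def sum_2)

lemma two_element_isometry:
  fixes L :: "'a::idom ^ 2 ^ 2"
  assumes F2: "\<And>x :: 'a. x = 0 \<or> x = 1" and d: "det L \<noteq> 0"
    and iso: "L ** vector [vector [1, - 1], vector [0, 1]] ** transpose L = vector [vector [1, - 1], vector [0, 1]]"
  shows "L \<in> {mat 1, rot, rot ** rot}"
proof -
  have neg: "- 1 = (1 :: 'a)" using F2[of "- 1"] by auto
  have uminus: "- x = x" for x :: 'a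
  proof -
    have "- x = - 1 * x" by simp
    then show ?thesis unfolding neg by simp
  qed
  have two: "(2 :: 'a) = 0" by (metis uminus add.right_inverse one_add_one)
  have "(L ** vector [vector [1, - 1], vector [0, 1]] ** transpose L) $ 1 $ 2 = - 1"
    unfolding iso by simp
  then have e: "L $ 1 $ 1 * L $ 2 $ 1 + L $ 1 $ 1 * L $ 2 $ 2 + L $ 1 $ 2 * L $ 2 $ 2 = 1"
    by (simp add: uminus matrix_matrix_mult_def sum_2 transpose_def algebra_simps)
  have d': "L $ 1 $ 1 * L $ 2 $ 2 \<noteq> L $ 1 $ 2 * L $ 2 $ 1"
    using d by (simp add: det_2)
  have "L $ 1 $ 1 = 1 \<and> L $ 1 $ 2 = 0 \<and> L $ 2 $ 1 = 0 \<and> L $ 2 $ 2 = 1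
      \<or> L $ 1 $ 1 = 1 \<and> L $ 1 $ 2 = 1 \<and> L $ 2 $ 1 = 1 \<and> L $ 2 $ 2 = 0
      \<or> L $ 1 $ 1 = 0 \<and> L $ 1 $ 2 = 1 \<and> L $ 2 $ 1 = 1 \<and> L $ 2 $ 2 = 1"
  proof (cases "L $ 1 $ 1 = 0")
    case True
    then have "L $ 1 $ 2 = 1" "L $ 2 $ 1 = 1" using d' F2[of "L $ 1 $ 2"] F2[of "L $ 2 $ 1"] by auto
    with True e show ?thesis by simp
  next
    case False
    then have 11: "L $ 1 $ 1 = 1" using F2 by blast
    show ?thesis
    proof (cases "L $ 2 $ 2 = 0")
      case True
      then have "L $ 2 $ 1 = 1" "L $ 1 $ 2 \<noteq> 0" using e d' 11 by auto
      with True 11 show ?thesis using F2[of "L $ 1 $ 2"] by simp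
    next
      case False
      then have 22: "L $ 2 $ 2 = 1" using F2 by blast
      have "L $ 1 $ 2 + L $ 2 $ 1 = 0" using e 11 22 by (simp add: ac_simps)
      then have "L $ 1 $ 2 = L $ 2 $ 1" by (metis uminus add_eq_0_iff)
      moreover have "L $ 1 $ 2 = 0 \<or> L $ 1 $ 2 = 1" by (rule F2)
      ultimately show ?thesis using d' 11 22 by auto
    qed
  qed
  then show ?thesis
    unfolding rot_square unfolding rot_def uminus by (elim disjE) (simp_all add: vec_eq_iff forall_2 mat_def)
qed

text \<open>The reduced matrices, up to scalars, of the elements in the image of the braid group.\<close>
definition realizable :: "'a::comm_ring_1 laurent ^ 2 ^ 2 \<Rightarrow> bool" where
  "realizable g \<longleftrightarrow> (\<exists>c w. g = mat c ** reduced_mat (burau_word w))"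

lemma realizable_scalar:
  assumes "realizable g"
  shows "realizable (mat c ** g)"
proof -
  from assms obtain b w where g: "g = mat b ** reduced_mat (burau_word w)"
    unfolding realizable_def by blast
  have "mat c ** g = mat (c * b) ** reduced_mat (burau_word w)"
    unfolding g by (simp only: matrix_mul_assoc mat_mult_mat)
  then show ?thesis unfolding realizable_def by blast
qed

lemma realizable_mult:
  assumes "realizable g" "realizable h"
  shows "realizable (g ** h)"
proof -
  from assms obtain a b u w where g: "g = mat a ** reduced_mat (burau_word u)" and h: "h = mat b ** reduced_mat (burau_word w)"
    unfolding realizable_def by blast
  have "g ** h = mat a ** (mat b ** (reduced_mat (burau_word u) ** reduced_mat (burau_word w)))"
    unfolding g h by (simp only: scalar_left[of "reduced_mat _"] matrix_mul_assoc[symmetric])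
  also have "\<dots> = mat (a * b) ** reduced_mat (burau_word (u @ w))"
    by (simp only: burau_word_append reduced_mult[OF burau_word_row_sum] matrix_mul_assoc mat_mult_mat)
  finally show ?thesis unfolding realizable_def by blast
qed

lemma realizable_one: "realizable (mat 1)"
proof -
  have "mat 1 = mat 1 ** reduced_mat (burau_word [])" by (simp add: reduced_one)
  then show ?thesis unfolding realizable_def by blast
qed

lemma realizable_word: "realizable (reduced_mat (burau_word w))"
  unfolding realizable_def by (rule exI[of _ 1], rule exI[of _ w]) simp

lemma realizable_rot: "realizable (rot :: 'a::comm_ring_1 laurent ^ 2 ^ 2)"
  and realizable_flip: "realizable (flip :: 'a laurent ^ 2 ^ 2)"
proof -
  have s: "realizable (reduced_mat (burau_gen s) :: 'a laurent ^ 2 ^ 2)" for s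
    using realizable_word[of "[(s, True)]"] by simp
  have cancel: "mat (- 1) ** (mat (- 1) ** g) = g" for g :: "'a laurent ^ 2 ^ 2"
    by (simp add: matrix_mul_assoc mat_mult_mat)
  have rrf: "realizable (rot ** (rot ** flip) :: 'a laurent ^ 2 ^ 2)"
    and frr: "realizable (flip ** (rot ** rot) :: 'a laurent ^ 2 ^ 2)"
    using realizable_scalar[OF s, of "- 1" Sigma1] realizable_scalar[OF s, of "- 1" Sigma2]
    unfolding reduced_Sigma1 reduced_Sigma2 cancel by blast+
  have prod: "(rot ** (rot ** flip)) ** (flip ** (rot ** rot)) = mat lt ** (rot :: 'a laurent ^ 2 ^ 2)"
  proof -
    have "(rot ** (rot ** flip)) ** (flip ** (rot ** rot))
        = rot ** (rot ** (flip ** (flip ** (rot ** rot)))) " for flip rot :: "'a laurent ^ 2 ^ 2"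
      by (simp only: matrix_mul_assoc)
    also have "rot ** (rot ** (flip ** (flip ** (rot ** rot)))) = rot ** (rot ** (mat lt ** (rot ** rot)))"
      by (simp only: flip_square)
    also have "\<dots> = mat lt ** (rot ** (rot ** (rot ** rot)))"
      by (simp only: scalar_left[of rot])
    finally show ?thesis by (simp only: rot_cube)
  qed
  have "mat lt_inv ** ((rot ** (rot ** flip)) ** (flip ** (rot ** rot))) = (rot :: 'a laurent ^ 2 ^ 2)"
    unfolding prod by (simp add: matrix_mul_assoc mat_mult_mat)
  with realizable_scalar[OF realizable_mult[OF rrf frr], of lt_inv]
  show rot: "realizable (rot :: 'a laurent ^ 2 ^ 2)" by simp
  show "realizable (flip :: 'a laurent ^ 2 ^ 2)"
    using realizable_mult[OF rot rrf] by (simp only: rot_cube)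
qed

lemma unitary_rot: "unitary (rot :: 'a::comm_ring_1 laurent ^ 2 ^ 2)"
  by (simp add: unitary_def rot_def herm_def vec_eq_iff forall_2 matrix_matrix_mult_def sum_2
      transpose_def laurent_bar_uminus)

definition flip_inv :: "'a::comm_ring_1 laurent ^ 2 ^ 2" where
  "flip_inv = vector [vector [0, lt_inv], vector [1, 0]]"

lemma unitary_flip_inv: "unitary (flip_inv :: 'a::comm_ring_1 laurent ^ 2 ^ 2)"
  by (simp add: unitary_def flip_inv_def herm_def vec_eq_iff forall_2 matrix_matrix_mult_def sum_2
      transpose_def)
    (simp add: algebra_simps)

lemma flip_flip_inv: "flip ** flip_inv = mat 1"
  by (simp add: flip_def flip_inv_def vec_eq_iff forall_2 matrix_matrix_mult_def sum_2 mat_def)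

lemma two_element_singular:
  fixes L :: "'a::idom ^ 2 ^ 2"
  assumes F2: "\<And>x :: 'a. x = 0 \<or> x = 1" and d: "det L = 0"
  shows "L $ 1 = 0 \<or> L $ 2 = 0 \<or> L $ 1 = L $ 2"
proof -
  have d': "L $ 1 $ 1 * L $ 2 $ 2 = L $ 1 $ 2 * L $ 2 $ 1" using d by (simp add: det_2)
  have "L $ i $ j = 0 \<or> L $ i $ j = 1" for i j by (rule F2)
  from this[of 1 1] this[of 1 2] this[of 2 1] this[of 2 2] d' show ?thesis
    unfolding vec_eq_iff forall_2 by (elim disjE) simp_all
qed

text \<open>Over the field with two elements there are only three lines, and \<open>rot\<close> permutes them cyclically, so
  any matrix of rank one can be rotated to have column space spanned by \<open>(0,1)\<close>.\<close>
lemma two_element_rotate: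
  fixes L :: "'a::idom ^ 2 ^ 2"
  assumes F2: "\<And>x :: 'a. x = 0 \<or> x = 1" and d: "det L = 0"
  shows "L $ 1 = 0 \<or> (rot ** L) $ 1 = 0 \<or> (rot ** (rot ** L)) $ 1 = 0"
proof -
  have "1 + - 1 = (0 :: 'a)" by simp
  moreover have "- 1 = (1 :: 'a)" using F2[of "- 1"] by auto
  ultimately have "(2 :: 'a) = 0" by (metis one_add_one)
  then show ?thesis
    using two_element_singular[OF assms]
    by (auto simp: rot_def vec_eq_iff forall_2 matrix_matrix_mult_def sum_2)
qed

lemma lead_of_deg_le:
  assumes "\<And>i j. deg_le (A $ i $ j) n"
  shows "lead A n (\<chi> i j. Poly_Mapping.lookup (A $ i $ j) n)"
  using assms by (simp add: lead_def)

lemma flip_inv_lowers_degree: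
  assumes L: "lead h m L" "L $ 1 = 0"
  shows "\<exists>M. lead (flip_inv ** h) (m - 1) M"
proof -
  have h: "deg_le (h $ i $ j) m" "Poly_Mapping.lookup (h $ 1 $ j) m = 0" for i j
    using L by (simp_all add: lead_def)
  have "deg_le (lt_inv :: 'a laurent) (- 1)" by (simp add: deg_le_def lookup_lt_inv)
  from deg_le_mult[OF this h(1)] have "deg_le (lt_inv * h $ 2 $ j) (m - 1)" for j by simp
  moreover have "deg_le (h $ 1 $ j) (m - 1)" for j
    unfolding deg_le_def
  proof (intro allI impI)
    fix k assume "m - 1 < k"
    then show "Poly_Mapping.lookup (h $ 1 $ j) k = 0"
      using h(1)[of 1 j] h(2)[of j] by (cases "k = m") (auto simp: deg_le_def)
  qed
  ultimately have "deg_le ((flip_inv ** h) $ i $ j) (m - 1)" for i j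
    using exhaust_2[of i] by (auto simp: flip_inv_def matrix_matrix_mult_def sum_2)
  then show ?thesis using lead_of_deg_le by blast
qed

lemma lookup_det_flip_inv:
  fixes h :: "'a::comm_ring_1 laurent ^ 2 ^ 2"
  shows "Poly_Mapping.lookup (det (flip_inv ** h)) (n - 1) = - Poly_Mapping.lookup (det h) n"
proof -
  have s: "Poly_Mapping.lookup (lt_inv * f) (n - 1) = Poly_Mapping.lookup f n" for f :: "'a laurent"
    by (induction f rule: laurent_induct)
      (auto simp: lt_inv_def mult_single lookup_single when_def distrib_left lookup_add)
  have "det flip_inv = (- lt_inv :: 'a laurent)" by (simp add: det_2 flip_inv_def)
  then have "det (flip_inv ** h) = - (lt_inv * det h)" by (simp add: det_mul)
  then show ?thesis by (simp add: s)
qed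

text \<open>Induction on the distance between the standard vertex and its image under \<open>g\<close>, which is
  \<open>2 m - D\<close> for \<open>m\<close> the degree of \<open>g\<close> and \<open>D\<close> that of its determinant. With only upper and lower bounds for
  these degrees it becomes an upper bound for the distance, and a vanishing leading matrix is just
  another case in which the bound can be lowered.\<close>
lemma unitary_realizable:
  fixes g :: "'a::idom laurent ^ 2 ^ 2"
  assumes F2: "\<And>x :: 'a. x = 0 \<or> x = 1"
    and "unitary g" "lead g m L" "Poly_Mapping.lookup (det g) D \<noteq> 0"
  shows "realizable g"
  using assms(2-)
proof (induction "nat (2 * m - D)" arbitrary: g m L D rule: less_induct)
  case less
  note g = \<open>unitary g\<close> and L = \<open>lead g m L\<close> and D = \<open>Poly_Mapping.lookup (det g) D \<noteq> 0\<close>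
  show ?case
  proof (cases "det L = 0")
    case False
    have const: "g $ i $ j = Poly_Mapping.single m (L $ i $ j)" for i j
      by (rule unitary_lead_invertible[OF g L False])
    have "g = mat (Poly_Mapping.single m 1) ** (\<chi> i j. Poly_Mapping.single 0 (L $ i $ j))"
      by (simp add: vec_eq_iff forall_2 matrix_matrix_mult_def sum_2 mat_def const mult_single)
    moreover have "L \<in> {mat 1, rot, rot ** rot}"
      by (rule two_element_isometry[OF F2 False unitary_lead_isometry[OF g L False]])
    then have "(\<chi> i j. Poly_Mapping.single 0 (L $ i $ j)) \<in> {mat 1, rot, rot ** (rot :: 'a laurent ^ 2 ^ 2)}"
      unfolding rot_square
      by (auto simp: rot_def mat_def vec_eq_iff forall_2 single_uminus)
    ultimately show ?thesis
      using realizable_one realizable_rot realizable_mult[OF realizable_rot realizable_rot]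
      by (auto intro: realizable_scalar)
  next
    case True
    have "2 * m \<noteq> D" using lead_det(2)[OF L] D True by auto
    moreover have "\<not> D > 2 * m" using lead_det(1)[OF L] D by (auto simp: deg_le_def)
    ultimately have lt: "nat (2 * (m - 1) - (D - 1)) < nat (2 * m - D)" by simp
    \<comment> \<open>A vanishing first row of the leading matrix means that \<open>flip_inv\<close> moves toward the standard vertex: it
        lowers the degree of the matrix and that of the determinant by one each.\<close>
    have descend: "realizable h"
      if h: "unitary h" "lead h m M" "M $ 1 = 0" "det h = det g" for h M
    proof -
      obtain M' where M': "lead (flip_inv ** h) (m - 1) M'"
        using flip_inv_lowers_degree[OF h(2,3)] by blast
      have "Poly_Mapping.lookup (det (flip_inv ** h)) (D - 1) \<noteq> 0"
        unfolding lookup_det_flip_inv h(4) using D by simp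
      from less.hyps[OF lt unitary_mult[OF unitary_flip_inv h(1)] M' this]
      have "realizable (flip ** (flip_inv ** h))"
        by (rule realizable_mult[OF realizable_flip])
      then show ?thesis by (simp add: matrix_mul_assoc flip_flip_inv)
    qed
    have u: "unitary (rot ** g)" "unitary (rot ** (rot ** g))"
      by (intro unitary_mult unitary_rot g)+
    have l: "lead (rot ** g) m (rot ** L)" "lead (rot ** (rot ** g)) m (rot ** (rot ** L))"
      using lead_mult[OF lead_rot L] lead_mult[OF lead_rot lead_mult[OF lead_rot L]] by simp_all
    have dr: "det (rot :: 'a laurent ^ 2 ^ 2) = 1" by (simp add: det_2 rot_def)
    from two_element_rotate[OF F2 True] consider "L $ 1 = 0" | "(rot ** L) $ 1 = 0"
      | "(rot ** (rot ** L)) $ 1 = 0" by blast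
    then have "realizable g \<or> realizable (rot ** g) \<or> realizable (rot ** (rot ** g))"
      by cases (use descend[OF g L] descend[OF u(1) l(1)] descend[OF u(2) l(2)] in
          \<open>auto simp: det_mul dr\<close>)
    then show ?thesis
      by (metis realizable_mult[OF realizable_rot] rot_cube)
  qed
qed

section \<open>Passing to the quotient by the center\<close>

lemma scalar_of_commute_generators:
  fixes g :: "'a::idom laurent ^ 2 ^ 2"
  assumes "g ** reduced_mat (burau_gen Sigma1) = reduced_mat (burau_gen Sigma1) ** g"
    and "g ** reduced_mat (burau_gen Sigma2) = reduced_mat (burau_gen Sigma2) ** g"
  shows "g = mat (g $ 1 $ 1)"
proof -
  have R: "reduced_mat (burau_gen Sigma1) = vector [vector [- lt, 0], vector [lt, 1 :: 'a laurent]]"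
    "reduced_mat (burau_gen Sigma2) = vector [vector [1, 1], vector [0, - lt :: 'a laurent]]"
    unfolding reduced_Sigma1 reduced_Sigma2
    by (simp_all add: rot_def flip_def vec_eq_iff forall_2 matrix_matrix_mult_def sum_2 mat_def)
  have e1: "(g ** reduced_mat (burau_gen Sigma1)) $ 1 $ 1 = (reduced_mat (burau_gen Sigma1) ** g) $ 1 $ 1"
    and e2: "(g ** reduced_mat (burau_gen Sigma2)) $ i $ j = (reduced_mat (burau_gen Sigma2) ** g) $ i $ j" for i j
    using assms by simp_all
  have "lt * g $ 1 $ 2 = 0"
    using e1 unfolding R by (simp add: matrix_matrix_mult_def sum_2 mult.commute)
  then have g12: "g $ 1 $ 2 = 0" using lt_nonzero by (metis mult_eq_0_iff)
  have g21: "g $ 2 $ 1 = 0"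
    using e2[of 1 1] unfolding R by (simp add: matrix_matrix_mult_def sum_2)
  have "g $ 1 $ 1 = g $ 2 $ 2"
    using e2[of 1 2] g12 unfolding R by (simp add: matrix_matrix_mult_def sum_2)
  with g12 g21 show ?thesis by (simp add: vec_eq_iff forall_2 mat_def)
qed

lemma Gamma3_simps:
  "mult Gamma3 = (**)" "one Gamma3 = mat 1"
  by (simp_all add: Gamma3_def)

lemma Gamma3_D:
  assumes "A \<in> carrier Gamma3"
  shows "burau_v v* A = burau_v" "A *v 1 = 1" "invertible A"
  using assms by (simp_all add: Gamma3_def)

text \<open>The reduced matrices of the two braid generators have only scalars as common centralizer.\<close>
lemma reduced_center:
  fixes z :: "'a::idom laurent_mat3"
  assumes "z \<in> group_center Gamma3"
  shows "\<exists>c. c \<noteq> 0 \<and> reduced_mat z = mat c"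
proof -
  have comm: "z ** A = A ** z" if "A \<in> carrier Gamma3" for A
    using assms that by (simp_all add: group_center_def Gamma3_simps)
  have z: "z \<in> carrier Gamma3" using assms by (simp add: group_center_def)
  have "reduced_mat z ** reduced_mat (burau_gen s) = reduced_mat (burau_gen s) ** reduced_mat z" for s
    using comm[OF burau_gen_Gamma3[of s]]
    by (simp flip: reduced_mult[OF Gamma3_D(2)[OF z]] reduced_mult[OF burau_gen_row_sum])
  then have scalar: "reduced_mat z = mat (reduced_mat z $ 1 $ 1)"
    by (intro scalar_of_commute_generators)
  have "reduced_mat z ** reduced_mat (matrix_inv z) = mat 1"
    using matrix_inv_mult(1)[OF Gamma3_D(3)[OF z]]
    by (simp add: reduced_one flip: reduced_mult[OF Gamma3_D(2)[OF z]])
  then have "reduced_mat z \<noteq> 0"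
    by (auto simp: vec_eq_iff forall_2 matrix_matrix_mult_def sum_2 mat_def)
  with scalar have "reduced_mat z $ 1 $ 1 \<noteq> 0"
    by (metis mat_0)
  with scalar show ?thesis by blast
qed

text \<open>A scalar commutes with everything, and commutation can be tested on reduced matrices by
  \<open>reduced_inj\<close>. So the scalars left over in \<open>unitary_realizable\<close> vanish in the quotient, whatever
  their exponents.\<close>
lemma center_of_scalar:
  fixes z :: "'a::idom laurent_mat3"
  assumes z: "z \<in> carrier Gamma3" and scalar: "reduced_mat z = mat c"
  shows "z \<in> group_center Gamma3"
proof -
  have "z ** A = A ** z" if A: "A \<in> carrier Gamma3" for A
  proof -
    have "reduced_mat (z ** A) = reduced_mat (A ** z)"
      unfolding reduced_mult[OF Gamma3_D(2)[OF z]] reduced_mult[OF Gamma3_D(2)[OF A]] scalar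
      by (rule mat_mult_commute)
    with carrier_Gamma3_mult[OF z A] carrier_Gamma3_mult[OF A z] show ?thesis
      by (intro reduced_inj Gamma3_D)
  qed
  with z show ?thesis by (simp add: group_center_def Gamma3_simps)
qed

lemma q3_eq_iff:
  fixes A B :: "'a::idom laurent_mat3"
  assumes A: "A \<in> carrier Gamma3" and B: "B \<in> carrier Gamma3"
  shows "q3 A = q3 B \<longleftrightarrow> (\<exists>z\<in>group_center Gamma3. A = z ** B)"
proof -
  interpret G: group "Gamma3 :: 'a laurent_mat3 monoid" by (rule group_Gamma3)
  have sub: "subgroup (group_center Gamma3) (Gamma3 :: 'a laurent_mat3 monoid)"
    using G.normal_center by (rule normal_imp_subgroup)
  show ?thesis
  proof
    assume "q3 A = q3 B"
    then have "A \<in> group_center Gamma3 #>\<^bsub>Gamma3\<^esub> B"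
      using G.rcos_self[OF A sub] by (simp add: q3_def)
    then show "\<exists>z\<in>group_center Gamma3. A = z ** B"
      by (auto simp: r_coset_def Gamma3_simps)
  next
    assume "\<exists>z\<in>group_center Gamma3. A = z ** B"
    then have "A \<in> group_center Gamma3 #>\<^bsub>Gamma3\<^esub> B"
      by (auto simp: r_coset_def Gamma3_simps)
    then show "q3 A = q3 B"
      unfolding q3_def using G.repr_independence[OF _ B sub] by simp
  qed
qed

lemma image_q3_burau: "(q3 \<circ> burau) ` carrier B3 = q3 ` range burau_word"
  by (simp add: B3_def image_comp flip: range_burau)

lemma carrier_Gamma3_bar: "carrier Gamma3_bar = q3 ` carrier Gamma3"
  by (auto simp: Gamma3_bar_def FactGroup_def RCOSETS_def q3_def)

lemma surjective_two_elements:
  assumes F2: "\<And>x :: 'a::idom. x = 0 \<or> x = 1"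
  shows "(q3 \<circ> burau) ` carrier B3 = carrier (Gamma3_bar :: 'a laurent_mat3 set monoid)"
proof -
  have "\<exists>w. q3 A = q3 (burau_word w)" if A: "A \<in> carrier Gamma3" for A :: "'a laurent_mat3"
  proof -
    have u: "unitary (reduced_mat A)" by (rule unitary_reduced[OF A])
    obtain m L where L: "lead (reduced_mat A) m L" using exists_lead by blast
    have "det (reduced_mat A) * det (reduced_mat (matrix_inv A)) = 1"
    proof -
      have "reduced_mat A ** reduced_mat (matrix_inv A) = mat 1"
        using matrix_inv_mult(1)[OF Gamma3_D(3)[OF A]]
        by (simp add: reduced_one flip: reduced_mult[OF Gamma3_D(2)[OF A]])
      then show ?thesis by (metis det_I det_mul)
    qed
    then have "det (reduced_mat A) \<noteq> 0" by auto
    then obtain D where "Poly_Mapping.lookup (det (reduced_mat A)) D \<noteq> 0" using exists_degree by blast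
    then have "realizable (reduced_mat A)" by (rule unitary_realizable[OF F2 u L])
    then obtain c w where cw: "reduced_mat A = mat c ** reduced_mat (burau_word w)" unfolding realizable_def by blast
    let ?B = "burau_word w :: 'a laurent_mat3"
    have B: "?B \<in> carrier Gamma3" by (rule burau_word_Gamma3)
    note Binv = carrier_Gamma3_inv[OF B] matrix_inv_mult[OF Gamma3_D(3)[OF B]]
    have "reduced_mat (A ** matrix_inv ?B) = mat c ** reduced_mat (?B ** matrix_inv ?B)"
      by (simp add: reduced_mult[OF Gamma3_D(2)[OF A]] cw reduced_mult[OF Gamma3_D(2)[OF B]] matrix_mul_assoc)
    then have "A ** matrix_inv ?B \<in> group_center Gamma3"
      by (intro center_of_scalar[of _ c] carrier_Gamma3_mult A Binv) (simp add: Binv reduced_one)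
    moreover have "A = (A ** matrix_inv ?B) ** ?B"
      by (simp add: Binv flip: matrix_mul_assoc)
    ultimately show ?thesis using q3_eq_iff[OF A B] by blast
  qed
  then show ?thesis
    unfolding image_q3_burau carrier_Gamma3_bar
    using burau_word_Gamma3 by (auto simp: image_iff)
qed

text \<open>Two reflections in the same coset of the image modulo the center have a quotient whose reduced matrix is
  a scalar times one from the image, against \<open>reflection_not_in_image\<close>.\<close>
lemma reflection_separates:
  fixes F :: "nat \<Rightarrow> 'a::idom laurent"
  assumes F: "separated_factors F" and two: "(2 :: 'a) \<noteq> 0" and nm: "n < m"
    and z: "z \<in> group_center Gamma3"
  shows "reflection (F m) \<noteq> z ** (burau_word w ** reflection (F n))"
proof
  assume eq: "reflection (F m) = z ** (burau_word w ** reflection (F n))"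
  let ?g = "F m + lt * laurent_bar (F n) + 3 * (1 + lt) * F m * laurent_bar (F n)"
  have u: "unitary_factor (F n)" using F by (simp add: separated_factors_def)
  obtain d where d: "d \<ge> 1" "deg_le ?g d" "Poly_Mapping.lookup ?g d \<noteq> 0"
    using F nm unfolding separated_factors_def Let_def by blast
  obtain c where c: "c \<noteq> 0" "reduced_mat z = mat c" using reduced_center[OF z] by blast
  have zc: "z \<in> carrier Gamma3" using z by (simp add: group_center_def)
  have "reflection ?g = reflection (F m) ** reflection (lt * laurent_bar (F n))"
    unfolding reflection_mult by (rule arg_cong[where f = reflection]) (simp add: algebra_simps)
  also have "\<dots> = z ** burau_word w ** (reflection (F n) ** reflection (lt * laurent_bar (F n)))"
    unfolding eq by (simp only: matrix_mul_assoc)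
  also have "\<dots> = z ** burau_word w"
    by (simp add: reflection_inverse[OF u])
  finally have "reduced_mat (reflection ?g) = mat c ** reduced_mat (burau_word w)"
    by (simp add: reduced_mult[OF Gamma3_D(2)[OF zc]] c(2))
  with reflection_not_in_image[OF d(2,3,1) two c(1)] show False by blast
qed

lemma infinite_index:
  fixes F :: "nat \<Rightarrow> 'a::idom laurent"
  assumes F: "separated_factors F" and two: "(2 :: 'a) \<noteq> 0"
  shows "infinite (rcosets\<^bsub>Gamma3_bar :: 'a laurent_mat3 set monoid\<^esub> ((q3 \<circ> burau) ` carrier B3))"
proof -
  let ?G = "Gamma3_bar :: 'a laurent_mat3 set monoid" and ?H = "(q3 \<circ> burau) ` carrier B3"
  interpret q: group_hom B3 ?G "q3 \<circ> burau"
    by (intro group_hom.intro group_hom_axioms.intro group_B3 q3_burau_hom)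
      (simp add: Gamma3_bar_def normal.factorgroup_is_group group.normal_center group_Gamma3)
  have sub: "subgroup ?H ?G" by (rule q.img_is_subgroup)
  have reflection: "reflection (F n) \<in> carrier Gamma3" for n
    using F by (simp add: separated_factors_def reflection_Gamma3)
  then have q: "q3 (reflection (F n)) \<in> carrier ?G" for n by (auto simp: carrier_Gamma3_bar)
  have ne: "?H #>\<^bsub>?G\<^esub> q3 (reflection (F m)) \<noteq> ?H #>\<^bsub>?G\<^esub> q3 (reflection (F n))" if nm: "n < m" for m n
  proof
    assume "?H #>\<^bsub>?G\<^esub> q3 (reflection (F m)) = ?H #>\<^bsub>?G\<^esub> q3 (reflection (F n))"
    then have "q3 (reflection (F m)) \<in> ?H #>\<^bsub>?G\<^esub> q3 (reflection (F n))"
      using q.H.rcos_self[OF q sub] by metis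
    then obtain h where h: "h \<in> ?H" "q3 (reflection (F m)) = h \<otimes>\<^bsub>?G\<^esub> q3 (reflection (F n))"
      by (auto simp: r_coset_def)
    then obtain w where "h = q3 (burau_word w)" unfolding image_q3_burau by blast
    then have "q3 (reflection (F m)) = q3 (burau_word w ** reflection (F n))"
      using h(2) hom_mult[OF q3_hom burau_word_Gamma3 reflection] by (simp add: Gamma3_simps)
    then obtain z where "z \<in> group_center Gamma3" "reflection (F m) = z ** (burau_word w ** reflection (F n))"
      using q3_eq_iff[OF reflection carrier_Gamma3_mult[OF burau_word_Gamma3 reflection]] by blast
    with reflection_separates[OF F two nm] show False by blast
  qed
  have "inj (\<lambda>n. ?H #>\<^bsub>?G\<^esub> q3 (reflection (F n)))"
    by (rule linorder_injI) (use ne[symmetric] in blast)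
  then have "infinite (range (\<lambda>n. ?H #>\<^bsub>?G\<^esub> q3 (reflection (F n))))"
    by (rule range_inj_infinite)
  moreover have "range (\<lambda>n. ?H #>\<^bsub>?G\<^esub> q3 (reflection (F n))) \<subseteq> rcosets\<^bsub>?G\<^esub> ?H"
    using q by (auto simp: RCOSETS_def)
  ultimately show ?thesis by (rule infinite_super[rotated])
qed

lemma not_surjective_of_infinite_index:
  fixes G (structure)
  assumes "group G" "infinite (rcosets carrier G)"
  shows False
proof -
  interpret group G by fact
  have "rcosets carrier G \<subseteq> {carrier G}"
    using coset_join2[OF _ subgroup_self] by (auto simp: RCOSETS_def)
  with assms(2) show False by (meson finite.emptyI finite_insert finite_subset)
qed

theorem theorem1p2:
  "(CARD('p::prime_card) = 2 \<longrightarrow>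
      (q3 \<circ> burau) ` carrier B3 = carrier (Gamma3_bar :: 'p mod_ring laurent_mat3 set monoid)) \<and>
   (CARD('p) > 2 \<longrightarrow>
      (q3 \<circ> burau) ` carrier B3 \<noteq> carrier (Gamma3_bar :: 'p mod_ring laurent_mat3 set monoid) \<and>
      infinite (rcosets\<^bsub>Gamma3_bar :: 'p mod_ring laurent_mat3 set monoid\<^esub>
                  ((q3 \<circ> burau) ` carrier B3)))"
proof (intro conjI impI)
  assume "CARD('p) = 2"
  then have "{0, 1} = (UNIV :: 'p mod_ring set)"
    by (intro card_subset_eq) simp_all
  then have "x = 0 \<or> x = 1" for x :: "'p mod_ring" by auto
  then show "(q3 \<circ> burau) ` carrier B3 = carrier (Gamma3_bar :: 'p mod_ring laurent_mat3 set monoid)"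
    by (rule surjective_two_elements)
next
  let ?G = "Gamma3_bar :: 'p mod_ring laurent_mat3 set monoid"
  have index: "infinite (rcosets\<^bsub>?G\<^esub> ((q3 \<circ> burau) ` carrier B3))" if p: "CARD('p) > 2"
  proof -
    have two: "(2 :: 'p mod_ring) \<noteq> 0"
    proof
      assume "(2 :: 'p mod_ring) = 0"
      then have "of_nat 2 = (0 :: 'p mod_ring)" by simp
      then have "CHAR('p mod_ring) dvd 2" by (simp only: of_nat_eq_0_iff_char_dvd)
      with p show False by (auto dest: dvd_imp_le)
    qed
    obtain F :: "nat \<Rightarrow> 'p mod_ring laurent" where "separated_factors F"
      using separated_factors_char_3[where 'a = "'p mod_ring"]
        separated_factors_char_not_3[where 'a = "'p mod_ring"] by blast
    then show ?thesis by (rule infinite_index[OF _ two])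
  qed
  show "infinite (rcosets\<^bsub>?G\<^esub> ((q3 \<circ> burau) ` carrier B3))" if "CARD('p) > 2"
    using that by (rule index)
  have grp: "group ?G"
    by (simp add: Gamma3_bar_def normal.factorgroup_is_group group.normal_center group_Gamma3)
  show "(q3 \<circ> burau) ` carrier B3 \<noteq> carrier ?G" if "CARD('p) > 2"
  proof
    assume "(q3 \<circ> burau) ` carrier B3 = carrier ?G"
    with index[OF that] have "infinite (rcosets\<^bsub>?G\<^esub> carrier ?G)" by simp
    with grp show False by (rule not_surjective_of_infinite_index)
  qed
qed

end
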